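(* Let $S$ be a finite set, let $\lambda\in FL(S)^S$, let $t$ be a scalar-valued formal variable, and let $\Lambda_t(\lambda)\in FL(S)^S$ be the (unique) solution of the ordinary differential equation $$\Lambda_0(\lambda)=0\qquad\text{and}\qquad\frac{d\Lambda_t(\lambda)}{dt}=\frac{\mathrm{ad}_{tb}\Lambda_t(\lambda)}{e^{\mathrm{ad}_{tb}\Lambda_t(\lambda)}-1}\left(e^{\partial_{\Lambda_t(\lambda)}}(\lambda)\right).$$ Then $C^{t\lambda}=e^{-\partial_{\Lambda_t(\lambda)}}$ as automorphisms of $FL(S)$.
   Context: Everything is over $\mathbb Q$. $FL(S)$ is the degree-completed free Lie algebra on the finite set $S$ of degree 1 generators, and $FL(S)^S$ is the set of functions $\lambda=(\lambda_a)_{a\in S}$ with $\lambda_a\in FL(S)$, with componentwise bracket $[\cdot,\cdot]$. For $\lambda\in FL(S)^S$, $\partial_\lambda$ is the unique (continuous) derivation of $FL(S)$ with $\partial_\lambda(a)=[a,\lambda_a]$ for every $a\in S$; it acts on $FL(S)^S$ componentwise. The tangential bracket on $FL(S)^S$ is the Lie bracket $[\lambda_1,\lambda_2]_{tb}=[\lambda_1,\lambda_2]+\partial_{\lambda_1}\lambda_2-\partial_{\lambda_2}\lambda_1$, and $\mathrm{ad}_{tb}$ is the corresponding adjoint action, $(\mathrm{ad}_{tb}\lambda_1)(\lambda_2)=[\lambda_1,\lambda_2]_{tb}$. For $\mu\in FL(S)^S$, $C^\mu$ is the automorphism of $FL(S)$ defined on generators by $C^\mu(a)=e^{\mu_a}ae^{-\mu_a}=e^{\mathrm{ad}\,\mu_a}(a)$.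 Elements depending on $t$ have, in each degree, coefficients that are power series (in fact polynomials) in $t$. *)

theory Defs
  imports
    "HOL-Computational_Algebra.Formal_Power_Series"
    "HOL-Library.Groups_Big_Fun"
    "HOL-Library.FuncSet"
begin

section \<open>Noncommutative formal power series\<close>

text \<open>
  Formal series in noncommuting letters of type \<open>'a\<close> with coefficients in \<open>'k\<close>: a word is a list
  of letters, and its degree is its length. Two coefficient rings are used below: \<open>rat\<close>, and
  \<open>rat fps\<close>, the power series in the formal variable \<open>t\<close>, for the elements that depend on \<open>t\<close>.
\<close>

typedef ('a, 'k) ncs = "UNIV :: ('a list \<Rightarrow> 'k) set"
  morphisms ncs_coeff Abs_ncs ..

lemma ncs_coeff_Abs [simp]: "ncs_coeff (Abs_ncs f) = f"
  by (simp add: Abs_ncs_inverse)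

lemma ncs_eqI: "(\<And>w. ncs_coeff x w = ncs_coeff y w) \<Longrightarrow> x = y"
  by (metis ncs_coeff_inject ext)

instantiation ncs :: (type, comm_ring_1) ring_1
begin

definition "0 = Abs_ncs (\<lambda>_. 0)"
definition "1 = Abs_ncs (\<lambda>w. if w = [] then 1 else 0)"
definition "x + y = Abs_ncs (\<lambda>w. ncs_coeff x w + ncs_coeff y w)"
definition "x - y = Abs_ncs (\<lambda>w. ncs_coeff x w - ncs_coeff y w)"
definition "- x = Abs_ncs (\<lambda>w. - ncs_coeff x w)"
definition "x * y =
  Abs_ncs (\<lambda>w. \<Sum>i=0..length w. ncs_coeff x (take i w) * ncs_coeff y (drop i w))"

lemma ncs_coeff_simps [simp]:
  fixes x y :: "('a, 'b::comm_ring_1) ncs"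
  shows
  "ncs_coeff (0 :: ('a, 'b) ncs) w = 0"
  "ncs_coeff (1 :: ('a, 'b) ncs) w = (if w = [] then 1 else 0)"
  "ncs_coeff (x + y) w = ncs_coeff x w + ncs_coeff y w"
  "ncs_coeff (x - y) w = ncs_coeff x w - ncs_coeff y w"
  "ncs_coeff (- x) w = - ncs_coeff x w"
  by (simp_all add: zero_ncs_def one_ncs_def plus_ncs_def minus_ncs_def uminus_ncs_def)

lemma ncs_coeff_mult:
  fixes x y :: "('a, 'b::comm_ring_1) ncs"
  shows "ncs_coeff (x * y) w = (\<Sum>i=0..length w. ncs_coeff x (take i w) * ncs_coeff y (drop i w))"
  by (simp add: times_ncs_def)

instance
proof
  fix x y z :: "('a, 'b) ncs"
  show "x * y * z = x * (y * z)"
  proof (rule ncs_eqI)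
    fix w :: "'a list"
    define f where "f = (\<lambda>i j (l::nat). ncs_coeff x (take i w) *
      (ncs_coeff y (take j (drop i w)) * ncs_coeff z (drop (i + j) w)))"
    have "ncs_coeff (x * y * z) w
        = (\<Sum>j=0..length w. \<Sum>i=0..j. f i (j - i) (length w - j))"
      unfolding ncs_coeff_mult sum_distrib_right
      by (intro sum.cong) (auto simp: f_def drop_take min_def mult.assoc)
    also have "\<dots> = (\<Sum>j=0..length w. \<Sum>i=0..length w - j. f j i (length w - j - i))"
      by (rule fps_mult_assoc_lemma)
    also have "\<dots> = ncs_coeff (x * (y * z)) w"
      unfolding ncs_coeff_mult sum_distrib_left
      by (intro sum.cong) (auto simp: f_def add.commute)
    finally show "ncs_coeff (x * y * z) w = ncs_coeff (x * (y * z)) w" .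
  qed
  show "1 * x = x"
  proof (rule ncs_eqI)
    fix w :: "'a list"
    have "ncs_coeff (1 * x) w = (\<Sum>i=0..length w. if i = 0 then ncs_coeff x w else 0)"
      unfolding ncs_coeff_mult by (intro sum.cong) auto
    then show "ncs_coeff (1 * x) w = ncs_coeff x w" by simp
  qed
  show "x * 1 = x"
  proof (rule ncs_eqI)
    fix w :: "'a list"
    have "ncs_coeff (x * 1) w = (\<Sum>i=0..length w. if i = length w then ncs_coeff x w else 0)"
      unfolding ncs_coeff_mult by (intro sum.cong) auto
    then show "ncs_coeff (x * 1) w = ncs_coeff x w" by simp
  qed
  show "(0::('a, 'b) ncs) \<noteq> 1"
  proof
    assume "(0::('a, 'b) ncs) = 1"
    then have "ncs_coeff (0::('a, 'b) ncs) [] = ncs_coeff 1 []" by simp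
    then show False by simp
  qed
qed (auto intro!: ncs_eqI simp: ncs_coeff_mult algebra_simps sum.distrib)

end

definition ncs_map :: "('k \<Rightarrow> 'l) \<Rightarrow> ('a, 'k) ncs \<Rightarrow> ('a, 'l) ncs" where
  "ncs_map f x = Abs_ncs (\<lambda>w. f (ncs_coeff x w))"

definition ncs_scale :: "'k::comm_ring_1 \<Rightarrow> ('a, 'k) ncs \<Rightarrow> ('a, 'k) ncs" where
  "ncs_scale c x = Abs_ncs (\<lambda>w. c * ncs_coeff x w)"

definition word :: "'a list \<Rightarrow> ('a, 'k::comm_ring_1) ncs" where
  "word u = Abs_ncs (\<lambda>w. if w = u then 1 else 0)"

abbreviation letter :: "'a \<Rightarrow> ('a, 'k::comm_ring_1) ncs" where
  "letter a \<equiv> word [a]"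

definition hom_part :: "nat \<Rightarrow> ('a, 'k::comm_ring_1) ncs \<Rightarrow> ('a, 'k) ncs" where
  "hom_part n x = Abs_ncs (\<lambda>w. if length w = n then ncs_coeff x w else 0)"

definition lie :: "('a, 'k::comm_ring_1) ncs \<Rightarrow> ('a, 'k) ncs \<Rightarrow> ('a, 'k) ncs" where
  "lie x y = x * y - y * x"


section \<open>The free Lie algebra and its degree completion\<close>

text \<open>
  The free Lie algebra on \<open>S\<close> is realised as the Lie algebra of Lie polynomials, that is, the Lie
  subalgebra of the free associative algebra generated by the letters in \<open>S\<close>. The lemma
  \<open>lie_poly_universal\<close> below establishes its universal property.
\<close>

inductive_set lie_poly :: "'a set \<Rightarrow> ('a, 'k::comm_ring_1) ncs set" for S :: "'a set" where
  letter: "a \<in> S \<Longrightarrow> letter a \<in> lie_poly S"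
| zero: "0 \<in> lie_poly S"
| add: "x \<in> lie_poly S \<Longrightarrow> y \<in> lie_poly S \<Longrightarrow> x + y \<in> lie_poly S"
| scale: "x \<in> lie_poly S \<Longrightarrow> ncs_scale c x \<in> lie_poly S"
| lie: "x \<in> lie_poly S \<Longrightarrow> y \<in> lie_poly S \<Longrightarrow> lie x y \<in> lie_poly S"

text \<open>
  The degree completion is the product of the homogeneous components of the free Lie algebra.
  Over \<open>rat fps\<close> and for finite \<open>S\<close>, its elements are those having, in each degree, coefficients
  that are power series in \<open>t\<close> with respect to a basis of the rational free Lie algebra.
\<close>

definition FL :: "'a set \<Rightarrow> ('a, 'k::comm_ring_1) ncs set" where
  "FL S = {x. \<forall>n. hom_part n x \<in> lie_poly S}"

text \<open>
  A function from \<open>S\<close> to \<open>FL S\<close> is represented by its extension by zero to all letters, so that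
  equality of such functions is equality in HOL.
\<close>

definition FL_vec :: "'a set \<Rightarrow> ('a \<Rightarrow> ('a, 'k::comm_ring_1) ncs) set" where
  "FL_vec S = {v. (\<forall>a\<in>S. v a \<in> FL S) \<and> (\<forall>a. a \<notin> S \<longrightarrow> v a = 0)}"


subsection \<open>The universal property\<close>

locale lie_module = module scale
  for scale :: "'k::comm_ring_1 \<Rightarrow> 'b::ab_group_add \<Rightarrow> 'b" +
  fixes br :: "'b \<Rightarrow> 'b \<Rightarrow> 'b"
  assumes br_add_left: "br (x + y) z = br x z + br y z"
    and br_add_right: "br x (y + z) = br x y + br x z"
    and br_scale_left: "br (scale c x) y = scale c (br x y)"
    and br_scale_right: "br x (scale c y) = scale c (br x y)"
    and br_self: "br x x = 0"
    and br_jacobi: "br x (br y z) + br y (br z x) + br z (br x y) = 0"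

context lie_module
begin

lemma br_zero [simp]: "br 0 x = 0" "br x 0 = 0"
  using br_add_left[of 0 0 x] br_add_right[of x 0 0] by simp_all

lemma br_anti: "br x y = - br y x"
  using br_self[of "x + y"] br_self[of x] br_self[of y]
  by (simp add: br_add_left br_add_right eq_neg_iff_add_eq_0 add.commute)

lemma br_minus_right: "br x (- y) = - br x y"
  using br_add_right[of x y "- y"] by (simp add: eq_neg_iff_add_eq_0 add.commute)

lemma br_jacobi': "br (br x y) z = br x (br y z) - br y (br x z)"
proof -
  have "br (br x y) z = - br z (br x y)" by (rule br_anti)
  also have "\<dots> = br x (br y z) + br y (br z x)"
    using br_jacobi[of x y z] by (metis minus_unique add.commute)
  also have "br y (br z x) = - br y (br x z)"
    by (subst br_anti[of z x]) (rule br_minus_right)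
  finally show ?thesis by simp
qed

lemma br_sum_left: "br (sum f A) y = (\<Sum>i\<in>A. br (f i) y)"
  by (induction A rule: infinite_finite_induct) (auto simp: br_add_left)

lemma br_sum_right: "br y (sum f A) = (\<Sum>i\<in>A. br y (f i))"
  by (induction A rule: infinite_finite_induct) (auto simp: br_add_right)

end

definition supp :: "('a, 'k::comm_ring_1) ncs \<Rightarrow> 'a list set" where
  "supp x = {w. ncs_coeff x w \<noteq> 0}"

lemma ncs_coeff_more [simp]:
  "ncs_coeff (ncs_scale c x) w = c * ncs_coeff x w"
  "ncs_coeff (word u) w = (if w = u then 1 else 0)"
  "ncs_coeff (hom_part n x) w = (if length w = n then ncs_coeff x w else 0)"
  by (simp_all add: ncs_scale_def word_def hom_part_def)

lemma ncs_scale_mult: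
  "ncs_scale c x * y = ncs_scale c (x * y)" "x * ncs_scale c y = ncs_scale c (x * y)"
  by (rule ncs_eqI; simp add: ncs_coeff_mult sum_distrib_left algebra_simps)+

lemma supp_add: "supp (x + y) \<subseteq> supp x \<union> supp y"
  and supp_diff: "supp (x - y) \<subseteq> supp x \<union> supp y"
  and supp_scale: "supp (ncs_scale c x) \<subseteq> supp x"
  and supp_hom: "supp (hom_part n x) \<subseteq> supp x"
  and supp_zero: "supp 0 = {}"
  and supp_word: "supp (word u) \<subseteq> {u}"
  by (auto simp: supp_def split: if_splits)

lemma supp_mult: "supp (x * y) \<subseteq> (\<lambda>(u, v). u @ v) ` (supp x \<times> supp y)"
proof
  fix w assume "w \<in> supp (x * y)"
  then have "(\<Sum>i=0..length w. ncs_coeff x (take i w) * ncs_coeff y (drop i w)) \<noteq> 0"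
    by (simp add: supp_def ncs_coeff_mult)
  then obtain i where "ncs_coeff x (take i w) * ncs_coeff y (drop i w) \<noteq> 0"
    by (metis (mono_tags, lifting) sum.neutral)
  then have "take i w \<in> supp x" "drop i w \<in> supp y" by (auto simp: supp_def)
  then show "w \<in> (\<lambda>(u, v). u @ v) ` (supp x \<times> supp y)"
    by (intro image_eqI[of _ _ "(take i w, drop i w)"]) auto
qed

lemma finite_supp_mult: "finite (supp x) \<Longrightarrow> finite (supp y) \<Longrightarrow> finite (supp (x * y))"
  by (rule finite_subset[OF supp_mult]) auto

lemma finite_supp_lie: "finite (supp x) \<Longrightarrow> finite (supp y) \<Longrightarrow> finite (supp (lie x y))"
  unfolding lie_def by (rule finite_subset[OF supp_diff]) (auto intro: finite_supp_mult)

lemma finite_supp_lie_poly: "x \<in> lie_poly S \<Longrightarrow> finite (supp x)"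
  by (induction rule: lie_poly.induct)
    (auto intro: finite_supp_lie finite_subset[OF supp_add] finite_subset[OF supp_scale]
      finite_subset[OF supp_word] simp: supp_zero)

lemma finite_supp_induct [consumes 1, case_names zero add]:
  fixes x :: "('a, 'k::comm_ring_1) ncs"
  assumes fin: "finite (supp x)" and 0: "P 0"
    and add: "\<And>x c u. finite (supp x) \<Longrightarrow> P x \<Longrightarrow> P (x + ncs_scale c (word u))"
  shows "P x"
proof -
  have "\<forall>x :: ('a, 'k) ncs. supp x \<subseteq> A \<longrightarrow> P x" if "finite A" for A
    using that
  proof (induction A)
    case empty
    then show ?case
      using 0 by (auto simp: supp_def) (metis ncs_coeff_simps(1) ncs_eqI)
  next
    case (insert u A)
    show ?case
    proof (intro allI impI)
      fix x :: "('a, 'k) ncs" assume x: "supp x \<subseteq> insert u A"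
      define y where "y = x - ncs_scale (ncs_coeff x u) (word u)"
      have "supp y \<subseteq> A" using x by (auto simp: y_def supp_def split: if_splits)
      then have "P (y + ncs_scale (ncs_coeff x u) (word u))"
        using insert finite_subset by (intro add) blast+
      then show "P x" by (simp add: y_def)
    qed
  qed
  with fin show ?thesis by blast
qed

context lie_module
begin

definition lin :: "('a list \<Rightarrow> 'b) \<Rightarrow> ('a, 'k) ncs \<Rightarrow> 'b" where
  "lin g x = (\<Sum>w\<in>supp x. scale (ncs_coeff x w) (g w))"

lemma lin_superset:
  assumes "finite A" "supp x \<subseteq> A"
  shows "lin g x = (\<Sum>w\<in>A. scale (ncs_coeff x w) (g w))"
  unfolding lin_def using assms by (intro sum.mono_neutral_left) (auto simp: supp_def)

lemma lin_zero [simp]: "lin g 0 = 0"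
  by (simp add: lin_def supp_zero)

lemma lin_word [simp]: "lin g (word u) = g u"
  by (subst lin_superset[of "{u}"]) (auto simp: supp_word[THEN subsetD] supp_def split: if_splits)

lemma lin_add:
  assumes "finite (supp x)" "finite (supp y)"
  shows "lin g (x + y) = lin g x + lin g y"
  using assms supp_add[of x y]
  by (simp add: lin_superset[of "supp x \<union> supp y"] scale_left_distrib sum.distrib)

lemma lin_diff:
  assumes "finite (supp x)" "finite (supp y)"
  shows "lin g (x - y) = lin g x - lin g y"
  using assms supp_diff[of x y]
  by (simp add: lin_superset[of "supp x \<union> supp y"] scale_left_diff_distrib sum_subtractf)

lemma lin_scale:
  assumes "finite (supp x)"
  shows "lin g (ncs_scale c x) = scale c (lin g x)"
  using assms supp_scale[of c x]
  by (simp add: lin_superset[of "supp x"] scale_sum_right)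

lemmas lin_simps = lin_add lin_diff lin_scale

lemma finite_supp_intros:
  "finite (supp (word u))"
  "finite (supp x) \<Longrightarrow> finite (supp (ncs_scale c x))"
  "finite (supp x) \<Longrightarrow> finite (supp y) \<Longrightarrow> finite (supp (x + y))"
  "finite (supp x) \<Longrightarrow> finite (supp (hom_part n x))"
  by (auto intro: finite_subset[OF supp_add] finite_subset[OF supp_scale]
      finite_subset[OF supp_word] finite_subset[OF supp_hom])

text \<open>
  The nested bracket of a word, and the action of a word by iterated adjoint action. Uniqueness
  in the universal property is immediate; existence follows the Dynkin-Specht-Wever argument:
  the map that divides the nested bracket of each word by its length extends the given map on
  letters and respects brackets.
\<close>

fun nest :: "('a \<Rightarrow> 'b) \<Rightarrow> 'a list \<Rightarrow> 'b" where
  "nest f [] = 0"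
| "nest f [a] = f a"
| "nest f (a # w) = br (f a) (nest f w)"

fun act :: "('a \<Rightarrow> 'b) \<Rightarrow> 'a list \<Rightarrow> 'b \<Rightarrow> 'b" where
  "act f [] v = v"
| "act f (a # w) v = br (f a) (act f w v)"

lemma act_append: "act f (u @ w) v = act f u (act f w v)"
  by (induction u) auto

lemma nest_append: "w \<noteq> [] \<Longrightarrow> nest f (u @ w) = act f u (nest f w)"
proof (induction u)
  case (Cons a u)
  then show ?case by (cases "u @ w") auto
qed simp

lemma act_zero [simp]: "act f u 0 = 0"
  by (induction u) auto

lemma act_add: "act f u (v + v') = act f u v + act f u v'"
  by (induction u) (auto simp: br_add_right)

lemma act_scale: "act f u (scale c v) = scale c (act f u v)"
  by (induction u) (auto simp: br_scale_right)

definition Act :: "('a \<Rightarrow> 'b) \<Rightarrow> ('a, 'k) ncs \<Rightarrow> 'b \<Rightarrow> 'b" where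
  "Act f x v = lin (\<lambda>w. act f w v) x"

lemma Act_add_right:
  "finite (supp x) \<Longrightarrow> Act f x (v + v') = Act f x v + Act f x v'"
  unfolding Act_def lin_def by (simp add: act_add scale_right_distrib sum.distrib)

lemma Act_scale_right:
  "finite (supp x) \<Longrightarrow> Act f x (scale c v) = scale c (Act f x v)"
  unfolding Act_def lin_def by (simp add: act_scale scale_sum_right mult.commute)

lemma Act_zero_right [simp]: "Act f x 0 = 0"
  by (simp add: Act_def lin_def)

lemma word_lin_mult:
  assumes "finite (supp y)"
    and "\<And>w. w \<in> supp y \<Longrightarrow> g (u @ w) = act f u (h w)"
  shows "lin g (word u * y) = act f u (lin h y)"
proof -
  have eq: "ncs_coeff (word u * y) (u @ w) = ncs_coeff y w" for w
  proof -
    have pre: "(take i (u @ w) = u) = (i = length u)" if "i \<le> length (u @ w)" for i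
      using that by (metis append_eq_conv_conj length_take min.absorb2)
    have "ncs_coeff (word u * y) (u @ w)
      = (\<Sum>i=0..length (u @ w). if i = length u then ncs_coeff y w else 0)"
      unfolding ncs_coeff_mult
    proof (intro sum.cong refl)
      fix i assume "i \<in> {0..length (u @ w)}"
      then show "ncs_coeff (word u) (take i (u @ w)) * ncs_coeff y (drop i (u @ w))
          = (if i = length u then ncs_coeff y w else 0)"
        using pre[of i] by (cases "i = length u") (simp_all del: take_append)
    qed
    then show ?thesis by simp
  qed
  have sub: "supp (word u * y) \<subseteq> (\<lambda>w. u @ w) ` supp y"
    using supp_mult[of "word u" y] supp_word[of u] by fastforce
  have act_sum: "act f u (sum k A) = (\<Sum>i\<in>A. act f u (k i))" if "finite A" for k and A :: "'a list set"
    using that by (induction A) (auto simp: act_add)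
  have "lin g (word u * y)
      = (\<Sum>w\<in>(\<lambda>w. u @ w) ` supp y. scale (ncs_coeff (word u * y) w) (g w))"
    using assms(1) sub by (intro lin_superset) auto
  also have "\<dots> = (\<Sum>w\<in>supp y. scale (ncs_coeff y w) (g (u @ w)))"
    by (subst sum.reindex) (auto simp: eq inj_on_def)
  also have "\<dots> = (\<Sum>w\<in>supp y. act f u (scale (ncs_coeff y w) (h w)))"
    by (intro sum.cong refl) (simp add: assms(2) act_scale)
  also have "\<dots> = act f u (lin h y)"
    using assms(1) by (simp add: lin_def act_sum)
  finally show ?thesis .
qed

lemma lin_mult:
  assumes "finite (supp x)" "finite (supp y)"
    and "\<And>u w. w \<in> supp y \<Longrightarrow> g (u @ w) = act f u (h w)"
  shows "lin g (x * y) = Act f x (lin h y)"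
  using assms(1)
proof (induction rule: finite_supp_induct)
  case zero
  then show ?case by (simp add: Act_def)
next
  case (add x c u)
  have "lin g ((x + ncs_scale c (word u)) * y) = lin g (x * y) + scale c (lin g (word u * y))"
    using add.hyps assms(2)
    by (simp add: distrib_right ncs_scale_mult lin_simps finite_supp_mult finite_supp_intros)
  also have "lin g (word u * y) = act f u (lin h y)"
    using assms by (intro word_lin_mult) auto
  finally show ?case
    using add by (simp add: Act_def lin_simps finite_supp_intros)
qed

definition dsw :: "(nat \<Rightarrow> 'k) \<Rightarrow> ('a \<Rightarrow> 'b) \<Rightarrow> ('a, 'k) ncs \<Rightarrow> 'b" where
  "dsw r f = lin (\<lambda>w. scale (r (length w)) (nest f w))"

definition homog :: "nat \<Rightarrow> ('a, 'k) ncs \<Rightarrow> bool" where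
  "homog n x \<longleftrightarrow> finite (supp x) \<and> (\<forall>w\<in>supp x. length w = n)"

lemma homog_mult:
  assumes "homog m x" "homog n y"
  shows "homog (m + n) (x * y)"
proof -
  have "length w = m + n" if w: "w \<in> supp (x * y)" for w
  proof -
    obtain u v where "u \<in> supp x" "v \<in> supp y" "w = u @ v"
      using subsetD[OF supp_mult w] by auto
    then show ?thesis using assms by (simp add: homog_def)
  qed
  then show ?thesis using assms by (simp add: homog_def finite_supp_mult)
qed

lemma homog_lie:
  assumes "homog m x" "homog n y"
  shows "homog (m + n) (lie x y)"
proof -
  have "homog (m + n) (x * y)" "homog (m + n) (y * x)"
    using homog_mult[OF assms] homog_mult[OF assms(2,1)] by (simp_all add: add.commute)
  moreover have "finite (supp (lie x y))"
    using assms by (simp add: homog_def finite_supp_lie)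
  ultimately show ?thesis
    using supp_diff[of "x * y" "y * x"] unfolding homog_def lie_def by blast
qed

lemma homog_hom_part: "finite (supp x) \<Longrightarrow> homog n (hom_part n x)"
  unfolding homog_def by (auto simp: finite_supp_intros) (auto simp: supp_def split: if_splits)

lemma dsw_homog:
  assumes "homog n x"
  shows "dsw r f x = scale (r n) (lin (nest f) x)"
  using assms unfolding dsw_def lin_def homog_def
  by (simp add: scale_sum_right mult.commute)

lemma nest_homog:
  assumes "homog n x" "r n * of_nat n = 1"
  shows "lin (nest f) x = scale (of_nat n) (dsw r f x)"
proof -
  have "scale (of_nat n) (dsw r f x) = scale (of_nat n * r n) (lin (nest f) x)"
    by (simp add: dsw_homog[OF assms(1)])
  then show ?thesis using assms(2) by (simp add: mult.commute)
qed

lemma dsw_lie_homog: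
  assumes r: "\<And>n. n > 0 \<Longrightarrow> r n * of_nat n = (1::'k)"
    and x: "homog m x" "\<And>v. Act f x v = br (dsw r f x) v"
    and y: "homog n y" "\<And>v. Act f y v = br (dsw r f y) v"
    and pos: "m > 0" "n > 0"
  shows "dsw r f (lie x y) = br (dsw r f x) (dsw r f y)"
    and "Act f (lie x y) v = br (dsw r f (lie x y)) v"
proof -
  have fin: "finite (supp x)" "finite (supp y)" using x y by (auto simp: homog_def)
  have 1: "lin (nest f) (x * y) = Act f x (lin (nest f) y)"
    using fin y pos by (intro lin_mult nest_append) (auto simp: homog_def)
  have 2: "lin (nest f) (y * x) = Act f y (lin (nest f) x)"
    using fin x pos by (intro lin_mult nest_append) (auto simp: homog_def)
  have "lin (nest f) (lie x y) = Act f x (lin (nest f) y) - Act f y (lin (nest f) x)"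
    unfolding lie_def using fin by (simp add: lin_diff finite_supp_mult 1 2)
  also have "\<dots> = scale (of_nat n) (br (dsw r f x) (dsw r f y))
      - scale (of_nat m) (br (dsw r f y) (dsw r f x))"
    using pos by (simp add: nest_homog[of n y r f, OF y(1) r[OF pos(2)]]
        nest_homog[of m x r f, OF x(1) r[OF pos(1)]] x(2) y(2) br_scale_right)
  also have "\<dots> = scale (of_nat (m + n)) (br (dsw r f x) (dsw r f y))"
    by (subst br_anti[of "dsw r f y"]) (simp add: scale_left_distrib add.commute)
  finally have "dsw r f (lie x y)
      = scale (r (m + n) * of_nat (m + n)) (br (dsw r f x) (dsw r f y))"
    using dsw_homog[OF homog_lie[OF x(1) y(1)], of r f] by simp
  also have "\<dots> = br (dsw r f x) (dsw r f y)" using r[of "m + n"] pos by simp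
  finally show *: "dsw r f (lie x y) = br (dsw r f x) (dsw r f y)" .
  have 3: "Act f (x * y) v = Act f x (Act f y v)" "Act f (y * x) v = Act f y (Act f x v)"
    unfolding Act_def[of f "x * y"] Act_def[of f "y * x"]
    using fin by (subst lin_mult[where f = f and h = "\<lambda>w. act f w v"];
        simp add: act_append Act_def)+
  have "Act f (lie x y) v = Act f x (Act f y v) - Act f y (Act f x v)"
    unfolding lie_def 3[symmetric] using fin by (simp add: Act_def lin_diff finite_supp_mult)
  also have "\<dots> = br (dsw r f (lie x y)) v"
    unfolding * by (simp add: x(2) y(2) br_jacobi')
  finally show "Act f (lie x y) v = br (dsw r f (lie x y)) v" .
qed

end

lemma hom_part_simps:
  "hom_part n 0 = 0"
  "hom_part n (x + y) = hom_part n x + hom_part n y"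
  "hom_part n (ncs_scale c x) = ncs_scale c (hom_part n x)"
  "hom_part n (word u) = (if length u = n then word u else 0)"
  by (rule ncs_eqI; auto)+

lemma ncs_coeff_sum: "ncs_coeff (sum f A) w = (\<Sum>i\<in>A. ncs_coeff (f i) w)"
  by (induction A rule: infinite_finite_induct) auto

lemma hom_part_mult:
  "hom_part n (x * y) = (\<Sum>i=0..n. hom_part i x * hom_part (n - i) y)"
proof (rule ncs_eqI)
  fix w :: "'a list"
  have "(\<Sum>i=0..n. ncs_coeff (hom_part i x * hom_part (n - i) y) w)
      = (if length w = n then ncs_coeff (x * y) w else 0)"
  proof (cases "length w = n")
    case True
    have "ncs_coeff (hom_part i x * hom_part (n - i) y) w
        = ncs_coeff x (take i w) * ncs_coeff y (drop i w)" if "i \<le> n" for i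
    proof -
      have "ncs_coeff (hom_part i x * hom_part (n - i) y) w
        = (\<Sum>j=0..length w. if j = i then ncs_coeff x (take i w) * ncs_coeff y (drop i w) else 0)"
        unfolding ncs_coeff_mult using that True by (intro sum.cong) auto
      then show ?thesis using that True by simp
    qed
    then show ?thesis using True by (simp add: ncs_coeff_mult)
  next
    case False
    have "ncs_coeff (hom_part i x * hom_part (n - i) y) w = 0" if "i \<le> n" for i
      unfolding ncs_coeff_mult using that False by (intro sum.neutral) auto
    then show ?thesis using False by simp
  qed
  then show "ncs_coeff (hom_part n (x * y)) w
      = ncs_coeff (\<Sum>i=0..n. hom_part i x * hom_part (n - i) y) w"
    by (simp add: ncs_coeff_sum)
qed

lemma hom_part_lie:
  "hom_part n (lie x y) = (\<Sum>i=0..n. lie (hom_part i x) (hom_part (n - i) y))"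
proof -
  have "hom_part n (y * x) = (\<Sum>i=0..n. hom_part (n - i) y * hom_part i x)"
    unfolding hom_part_mult
    by (rule sum.reindex_bij_witness[of _ "\<lambda>i. n - i" "\<lambda>i. n - i"]) auto
  moreover have "hom_part n (lie x y) = hom_part n (x * y) - hom_part n (y * x)"
    by (rule ncs_eqI) (simp add: lie_def)
  ultimately show ?thesis by (simp add: hom_part_mult lie_def sum_subtractf)
qed

lemma hom_part_lie_poly: "x \<in> lie_poly S \<Longrightarrow> hom_part n x \<in> lie_poly S"
proof (induction arbitrary: n rule: lie_poly.induct)
  case (lie x y)
  have "(\<Sum>i\<in>A. lie (hom_part i x) (hom_part (n - i) y)) \<in> lie_poly S" if "finite A" for A
    using that by (induction A) (auto intro: lie_poly.intros lie)
  then show ?case by (simp add: hom_part_lie)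
qed (auto simp: hom_part_simps intro: lie_poly.intros)

lemma lie_zero [simp]: "lie 0 x = 0" "lie x 0 = 0"
  by (simp_all add: lie_def)

lemma lie_sum: "lie (sum f A) (sum g B) = (\<Sum>i\<in>A. \<Sum>j\<in>B. lie (f i) (g j))"
  unfolding lie_def sum_subtractf by (simp add: sum_product) (rule sum.swap)

lemma hom_part_0_lie_poly: "x \<in> lie_poly S \<Longrightarrow> hom_part 0 x = 0"
proof (induction rule: lie_poly.induct)
  case (scale x c)
  have "ncs_scale c 0 = (0 :: ('a, 'b) ncs)" by (rule ncs_eqI) simp
  with scale show ?case by (simp add: hom_part_simps)
qed (simp_all add: hom_part_simps hom_part_lie)

lemma lie_poly_subset_FL: "lie_poly S \<subseteq> FL S"
  by (auto simp: FL_def hom_part_lie_poly)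

theorem lie_poly_universal:
  fixes scale :: "'k::comm_ring_1 \<Rightarrow> 'b::ab_group_add \<Rightarrow> 'b" and S :: "'a set" and f :: "'a \<Rightarrow> 'b"
  assumes "lie_module scale br"
    and char0: "\<And>n. n > 0 \<Longrightarrow> (of_nat n :: 'k) dvd 1"
  shows "\<exists>!\<phi> :: ('a, 'k) ncs \<Rightarrow> 'b. \<phi> \<in> extensional (lie_poly S) \<and>
    (\<forall>x\<in>lie_poly S. \<forall>y\<in>lie_poly S. \<phi> (x + y) = \<phi> x + \<phi> y) \<and>
    (\<forall>c. \<forall>x\<in>lie_poly S. \<phi> (ncs_scale c x) = scale c (\<phi> x)) \<and>
    (\<forall>x\<in>lie_poly S. \<forall>y\<in>lie_poly S. \<phi> (lie x y) = br (\<phi> x) (\<phi> y)) \<and>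
    (\<forall>a\<in>S. \<phi> (letter a) = f a)" (is "\<exists>!\<phi>. ?P \<phi>")
proof -
  interpret lie_module scale br by fact
  have "\<forall>n. \<exists>r. n > 0 \<longrightarrow> r * of_nat n = (1::'k)"
    using char0 by (metis dvdE mult.commute)
  then obtain r where r: "\<And>n. n > 0 \<Longrightarrow> r n * of_nat n = (1::'k)" by metis
  let ?\<phi> = "dsw r f :: ('a, 'k) ncs \<Rightarrow> 'b"
  have fin: "finite (supp x)" if "x \<in> lie_poly S" for x :: "('a, 'k) ncs"
    using that by (rule finite_supp_lie_poly)
  have finsum: "finite (supp (\<Sum>i\<in>A. g i))" if "finite A" "\<And>i. finite (supp (g i))"
    for A :: "nat set" and g :: "nat \<Rightarrow> ('a, 'k) ncs"
    using that by (induction A) (auto simp: supp_zero intro: finite_supp_intros)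
  have lin_sum: "lin g (\<Sum>i\<in>A. h i) = (\<Sum>i\<in>A. lin g (h i))"
    if "finite A" "\<And>i. finite (supp (h i))"
    for A :: "nat set" and h :: "nat \<Rightarrow> ('a, 'k) ncs" and g
    using that by (induction A) (auto simp: lin_add finsum)
  have ad: "Act f (hom_part n x) v = br (?\<phi> (hom_part n x)) v" if "x \<in> lie_poly S" for x n v
    using that
  proof (induction arbitrary: n v rule: lie_poly.induct)
    case (letter a)
    then show ?case using r[of 1] by (cases "n = 1") (auto simp: hom_part_simps Act_def dsw_def)
  next
    case (lie x y)
    have *: "Act f (lie (hom_part i x) (hom_part j y)) v
        = br (?\<phi> (lie (hom_part i x) (hom_part j y))) v" for i j v
    proof (cases "i = 0 \<or> j = 0")
      case True
      then have "lie (hom_part i x) (hom_part j y) = 0"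
        using lie.hyps by (auto simp: hom_part_0_lie_poly)
      then show ?thesis by (simp add: Act_def dsw_def)
    next
      case False
      then show ?thesis
        using lie by (intro dsw_lie_homog(2)[where m = i and n = j] r homog_hom_part fin) auto
    qed
    have "finite (supp (lie (hom_part i x) (hom_part j y)))" for i j
      using lie fin by (intro finite_supp_lie finite_supp_intros) auto
    then show ?case
      by (simp add: hom_part_lie Act_def dsw_def lin_sum br_sum_left
          flip: *[unfolded Act_def dsw_def])
  qed (auto simp: hom_part_simps Act_def dsw_def lin_simps fin finite_supp_intros
      br_add_left br_scale_left)
  have decomp: "\<exists>N. x = (\<Sum>i=0..N. hom_part i x)" if xp: "x \<in> lie_poly S" for x :: "('a, 'k) ncs"
  proof -
    obtain N where N: "\<And>w. w \<in> supp x \<Longrightarrow> length w \<le> N"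
      using fin[OF xp] finite_imageI[of "supp x" length]
      unfolding finite_nat_set_iff_bounded_le by auto
    have "x = (\<Sum>i=0..N. hom_part i x)"
      using N by (intro ncs_eqI) (fastforce simp: ncs_coeff_sum supp_def)
    then show ?thesis ..
  qed
  have hom: "?\<phi> (lie x y) = br (?\<phi> x) (?\<phi> y)" if xy: "x \<in> lie_poly S" "y \<in> lie_poly S" for x y
  proof -
    obtain M N where M: "x = (\<Sum>i=0..M. hom_part i x)" and N: "y = (\<Sum>i=0..N. hom_part i y)"
      using decomp xy by meson
    have *: "?\<phi> (lie (hom_part i x) (hom_part j y)) = br (?\<phi> (hom_part i x)) (?\<phi> (hom_part j y))"
      for i j
    proof (cases "i = 0 \<or> j = 0")
      case True
      then show ?thesis using xy by (auto simp: hom_part_0_lie_poly dsw_def)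
    next
      case False
      then show ?thesis
        using xy by (intro dsw_lie_homog(1)[where m = i and n = j] r homog_hom_part fin ad) auto
    qed
    have f1: "finite (supp (hom_part i x))" "finite (supp (hom_part j y))" for i j
      using xy fin by (auto intro: finite_supp_intros)
    have f2: "finite (supp (lie (hom_part i x) (hom_part j y)))" for i j
      by (intro finite_supp_lie f1)
    have "lie x y = lie (\<Sum>i=0..M. hom_part i x) (\<Sum>j=0..N. hom_part j y)"
      using M N by simp
    also have "\<dots> = (\<Sum>i=0..M. \<Sum>j=0..N. lie (hom_part i x) (hom_part j y))"
      by (rule lie_sum)
    finally have "lie x y = \<dots>" .
    then have "?\<phi> (lie x y) = (\<Sum>i=0..M. \<Sum>j=0..N. br (?\<phi> (hom_part i x)) (?\<phi> (hom_part j y)))"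
      using * by (simp add: dsw_def lin_sum finsum f2)
    also have "\<dots> = br (\<Sum>i=0..M. ?\<phi> (hom_part i x)) (\<Sum>j=0..N. ?\<phi> (hom_part j y))"
      by (simp add: br_sum_left br_sum_right) (rule sum.swap)
    also have "(\<Sum>i=0..M. ?\<phi> (hom_part i x)) = ?\<phi> x"
      using M by (metis (mono_tags, lifting) dsw_def f1(1) finite_atLeastAtMost lin_sum sum.cong)
    also have "(\<Sum>j=0..N. ?\<phi> (hom_part j y)) = ?\<phi> y"
      using N by (metis (mono_tags, lifting) dsw_def f1(2) finite_atLeastAtMost lin_sum sum.cong)
    finally show ?thesis .
  qed
  have ex: "?P (restrict ?\<phi> (lie_poly S))"
    using r[of 1] by (auto simp: hom lie_poly.intros) (auto simp: dsw_def lin_simps fin)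
  show ?thesis
  proof (rule ex1I)
    show "?P (restrict ?\<phi> (lie_poly S))" by (fact ex)
    fix \<psi> assume P: "?P \<psi>"
    have *: "\<psi> x = restrict ?\<phi> (lie_poly S) x" if "x \<in> lie_poly S" for x
      using that
    proof (induction rule: lie_poly.induct)
      case zero
      have "\<psi> (0 + 0) = \<psi> 0 + \<psi> 0" using P lie_poly.zero by blast
      then show ?case by (simp add: lie_poly.zero dsw_def)
    next
      case (lie x y)
      then show ?case using P ex by metis
    next
      case (add x y)
      then show ?case using P ex by metis
    next
      case (scale x c)
      then show ?case using P ex by metis
    next
      case (letter a)
      then show ?case using P ex by metis
    qed
    show "\<psi> = restrict ?\<phi> (lie_poly S)"
      by (rule extensionalityI[of _ "lie_poly S"]) (use P * in auto)
  qed
qed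

lemma of_nat_unit_rat: "n > 0 \<Longrightarrow> (of_nat n :: rat) dvd 1"
  by (simp add: dvd_field_iff)

lemma of_nat_unit_rat_fps: "n > 0 \<Longrightarrow> (of_nat n :: rat fps) dvd 1"
  by (simp add: fps_is_unit_iff)


section \<open>Derivations and automorphisms of the completed free Lie algebra\<close>

text \<open>Continuity refers to the topology given by the degree filtration.\<close>

definition continuous_FL ::
  "'a set \<Rightarrow> (('a, 'k::comm_ring_1) ncs \<Rightarrow> ('a, 'k) ncs) \<Rightarrow> bool" where
  "continuous_FL S T \<longleftrightarrow> (\<forall>n. \<exists>m. \<forall>x\<in>FL S. \<forall>y\<in>FL S.
     (\<forall>i<m. hom_part i x = hom_part i y) \<longrightarrow> (\<forall>i<n. hom_part i (T x) = hom_part i (T y)))"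

definition linear_FL ::
  "'a set \<Rightarrow> (('a, 'k::comm_ring_1) ncs \<Rightarrow> ('a, 'k) ncs) \<Rightarrow> bool" where
  "linear_FL S T \<longleftrightarrow>
     (\<forall>x\<in>FL S. \<forall>y\<in>FL S. T (x + y) = T x + T y) \<and>
     (\<forall>c. \<forall>x\<in>FL S. T (ncs_scale c x) = ncs_scale c (T x))"

definition lie_derivation ::
  "'a set \<Rightarrow> (('a, 'k::comm_ring_1) ncs \<Rightarrow> ('a, 'k) ncs) \<Rightarrow> bool" where
  "lie_derivation S D \<longleftrightarrow> D \<in> FL S \<rightarrow>\<^sub>E FL S \<and> linear_FL S D \<and> continuous_FL S D \<and>
     (\<forall>x\<in>FL S. \<forall>y\<in>FL S. D (lie x y) = lie (D x) y + lie x (D y))"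

definition lie_automorphism ::
  "'a set \<Rightarrow> (('a, 'k::comm_ring_1) ncs \<Rightarrow> ('a, 'k) ncs) \<Rightarrow> bool" where
  "lie_automorphism S F \<longleftrightarrow> F \<in> FL S \<rightarrow>\<^sub>E FL S \<and> linear_FL S F \<and> continuous_FL S F \<and>
     (\<forall>x\<in>FL S. \<forall>y\<in>FL S. F (lie x y) = lie (F x) (F y)) \<and>
     bij_betw F (FL S) (FL S)"

definition tder ::
  "'a set \<Rightarrow> ('a \<Rightarrow> ('a, 'k::comm_ring_1) ncs) \<Rightarrow> ('a, 'k) ncs \<Rightarrow> ('a, 'k) ncs" where
  "tder S v = (THE D. lie_derivation S D \<and> (\<forall>a\<in>S. D (letter a) = lie (letter a) (v a)))"

definition tb ::
  "'a set \<Rightarrow> ('a \<Rightarrow> ('a, 'k::comm_ring_1) ncs) \<Rightarrow> ('a \<Rightarrow> ('a, 'k) ncs) \<Rightarrow> 'a \<Rightarrow> ('a, 'k) ncs" where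
  "tb S u v = (\<lambda>a. lie (u a) (v a) + tder S u (v a) - tder S v (u a))"


section \<open>Power series in operators, and the differential equation\<close>

text \<open>
  The value at \<open>x\<close> of the operator \<open>\<Sum>n. F\<^sub>n T\<^sup>n\<close>, and its analogue for operators on families. For
  operators that raise degrees, as all those used below do, only finitely many terms contribute
  to each coefficient; \<open>Sum_any\<close> is the sum of these nonzero terms.
\<close>

definition op_series ::
  "rat fps \<Rightarrow> (('a, rat fps) ncs \<Rightarrow> ('a, rat fps) ncs) \<Rightarrow> ('a, rat fps) ncs \<Rightarrow> ('a, rat fps) ncs"
  where "op_series F T x =
    Abs_ncs (\<lambda>w. Sum_any (\<lambda>n. fps_const (fps_nth F n) * ncs_coeff ((T ^^ n) x) w))"

definition op_series_vec ::
  "rat fps \<Rightarrow> (('a \<Rightarrow> ('a, rat fps) ncs) \<Rightarrow> ('a \<Rightarrow> ('a, rat fps) ncs)) \<Rightarrow>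
    ('a \<Rightarrow> ('a, rat fps) ncs) \<Rightarrow> ('a \<Rightarrow> ('a, rat fps) ncs)"
  where "op_series_vec F T v = (\<lambda>a.
    Abs_ncs (\<lambda>w. Sum_any (\<lambda>n. fps_const (fps_nth F n) * ncs_coeff ((T ^^ n) v a) w)))"

abbreviation op_exp ::
  "(('a, rat fps) ncs \<Rightarrow> ('a, rat fps) ncs) \<Rightarrow> ('a, rat fps) ncs \<Rightarrow> ('a, rat fps) ncs" where
  "op_exp \<equiv> op_series (fps_exp 1)"

text \<open>The power series \<open>z / (e\<^sup>z - 1)\<close>; the division of power series cancels the common factor \<open>z\<close>.\<close>

definition todd_fps :: "rat fps" where
  "todd_fps = fps_X / (fps_exp 1 - 1)"

lemma todd_fps_mult: "todd_fps * (fps_exp 1 - 1) = fps_X"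
proof -
  have *: "fps_nth (fps_exp 1 - 1 :: rat fps) 0 = 0" "fps_nth (fps_exp 1 - 1 :: rat fps) 1 = 1"
    by simp_all
  then have "subdegree (fps_exp 1 - 1 :: rat fps) = 1"
    by (intro subdegreeI) auto
  moreover have "fps_exp 1 - 1 \<noteq> (0 :: rat fps)"
    using * by (metis fps_zero_nth zero_neq_one)
  ultimately have "(fps_exp 1 - 1 :: rat fps) dvd fps_X"
    by (simp add: fps_dvd_iff)
  then show ?thesis
    by (simp add: todd_fps_def)
qed

text \<open>\<open>C\<^sup>\<mu>\<close>, with \<open>e\<^sup>\<mu> a e\<^sup>-\<^sup>\<mu>\<close> written as \<open>e\<^bsup>ad \<mu>\<^esup> a\<close>.\<close>

definition tconj ::
  "'a set \<Rightarrow> ('a \<Rightarrow> ('a, rat fps) ncs) \<Rightarrow> ('a, rat fps) ncs \<Rightarrow> ('a, rat fps) ncs" where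
  "tconj S \<mu> = (THE F. lie_automorphism S F \<and>
     (\<forall>a\<in>S. F (letter a) = op_exp (lie (\<mu> a)) (letter a)))"

text \<open>
  Coefficientwise, \<open>fps_const\<close> embeds the elements not depending on \<open>t\<close>, multiplication by
  \<open>fps_X\<close> is multiplication by \<open>t\<close>, \<open>\<lambda>p. fps_nth p 0\<close> evaluates at \<open>t = 0\<close>, and \<open>fps_deriv\<close> is
  \<open>d/dt\<close>.
\<close>

definition const_vec :: "('a \<Rightarrow> ('a, rat) ncs) \<Rightarrow> 'a \<Rightarrow> ('a, rat fps) ncs" where
  "const_vec v = (\<lambda>a. ncs_map fps_const (v a))"

definition t_times_vec :: "('a \<Rightarrow> ('a, rat) ncs) \<Rightarrow> 'a \<Rightarrow> ('a, rat fps) ncs" where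
  "t_times_vec v = (\<lambda>a. ncs_scale fps_X (const_vec v a))"

definition Lambda_ode ::
  "'a set \<Rightarrow> ('a \<Rightarrow> ('a, rat) ncs) \<Rightarrow> ('a \<Rightarrow> ('a, rat fps) ncs) \<Rightarrow> bool" where
  "Lambda_ode S l L \<longleftrightarrow> L \<in> FL_vec S \<and>
     (\<forall>a\<in>S. ncs_map (\<lambda>p. fps_nth p 0) (L a) = 0) \<and>
     (\<forall>a\<in>S. ncs_map fps_deriv (L a) =
        op_series_vec todd_fps (tb S L) (\<lambda>b. op_exp (tder S L) (const_vec l b)) a)"

end

(*
  Extend every derivation and operator from FL(S) to all noncommutative series, so that domains
  play no role in the computations. Write D for the tangential derivation of Lambda_t. Commuting
  d/dt past e^D gives
    e^D o d/dt o e^(-D) = e^(ad D) (d/dt) = d/dt - sum_k (ad D)^k (dD/dt) / (k+1)!,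
  and since u |-> (tangential derivation of u) turns the tangential bracket into the commutator,
  the last sum is the tangential derivation of ((e^z - 1)/z)(ad_tb Lambda_t) (dLambda_t/dt), which
  is e^D lambda by the differential equation. Evaluating on x = e^(-D) a yields
  dx/dt = [lambda_a, x] with x = a at t = 0. The series e^(t ad lambda_a) a solves the same linear
  initial value problem, whose solution is unique because ad lambda_a raises the degree. For the
  same reason the integrated equation for Lambda_t is a contraction, which gives existence and
  uniqueness of Lambda_t.
*)

theory Submission imports Defs begin

section \<open>The degree filtration and locally finite sums\<close>

interpretation ncs: module "ncs_scale :: 'k::comm_ring_1 \<Rightarrow> ('a, 'k) ncs \<Rightarrow> ('a, 'k) ncs"
  by standard (rule ncs_eqI; simp add: algebra_simps)+

definition fil :: "nat \<Rightarrow> ('a, 'k::comm_ring_1) ncs \<Rightarrow> bool" where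
  "fil n x \<longleftrightarrow> (\<forall>w. length w < n \<longrightarrow> ncs_coeff x w = 0)"

lemma fil_0 [simp]: "fil 0 x"
  and fil_zero [simp]: "fil n 0"
  and fil_add: "fil n x \<Longrightarrow> fil n y \<Longrightarrow> fil n (x + y)"
  and fil_diff: "fil n x \<Longrightarrow> fil n y \<Longrightarrow> fil n (x - y)"
  and fil_minus: "fil n x \<Longrightarrow> fil n (- x)"
  and fil_scale: "fil n x \<Longrightarrow> fil n (ncs_scale c x)"
  and fil_mono: "fil n x \<Longrightarrow> m \<le> n \<Longrightarrow> fil m x"
  by (auto simp: fil_def)

lemma fil_sum: "(\<And>i. i \<in> A \<Longrightarrow> fil n (f i)) \<Longrightarrow> fil n (sum f A)"
  by (induction A rule: infinite_finite_induct) (auto intro: fil_add)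

lemma fil_mult:
  assumes "fil m x" "fil n y"
  shows "fil (m + n) (x * y)"
  unfolding fil_def ncs_coeff_mult
proof (intro allI impI sum.neutral ballI)
  fix w :: "'a list" and i assume "length w < m + n" "i \<in> {0..length w}"
  then have "length (take i w) < m \<or> length (drop i w) < n" by auto
  then show "ncs_coeff x (take i w) * ncs_coeff y (drop i w) = 0"
    using assms by (auto simp: fil_def)
qed

lemma fil_lie: "fil m x \<Longrightarrow> fil n y \<Longrightarrow> fil (m + n) (lie x y)"
  using fil_mult[of m x n y] fil_mult[of n y m x] by (simp add: lie_def fil_diff add.commute)

lemma fil_eqI:
  assumes "\<And>n. fil n (x - y)"
  shows "x = y"
proof (rule ncs_eqI)
  fix w
  show "ncs_coeff x w = ncs_coeff y w" using assms[of "Suc (length w)"] by (simp add: fil_def)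
qed

lemma fil_triangle: "fil n (x - y) \<Longrightarrow> fil n (y - z) \<Longrightarrow> fil n (x - z)"
  using fil_add[of n "x - y" "y - z"] by simp

lemma fil_commute: "fil n (x - y) \<Longrightarrow> fil n (y - x)"
  using fil_minus[of n "x - y"] by simp

lemma fil_diff_iff: "fil n (x - y) \<longleftrightarrow> (\<forall>i<n. hom_part i x = hom_part i y)"
proof
  assume *: "fil n (x - y)"
  then show "\<forall>i<n. hom_part i x = hom_part i y"
    by (intro allI impI ncs_eqI) (auto simp: fil_def)
next
  assume *: "\<forall>i<n. hom_part i x = hom_part i y"
  have "ncs_coeff x w = ncs_coeff y w" if "length w < n" for w
    using * that by (metis ncs_coeff_more(3))
  then show "fil n (x - y)" by (simp add: fil_def)
qed

text \<open>This is the infinite sum only for families with \<open>fil k (f k)\<close> for all \<open>k\<close>.\<close>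

definition nsum :: "(nat \<Rightarrow> ('a, 'k::comm_ring_1) ncs) \<Rightarrow> ('a, 'k) ncs" where
  "nsum f = Abs_ncs (\<lambda>w. \<Sum>k\<le>length w. ncs_coeff (f k) w)"

lemma ncs_coeff_nsum:
  assumes "\<And>k. fil k (f k)" "length w < n"
  shows "ncs_coeff (nsum f) w = (\<Sum>k<n. ncs_coeff (f k) w)"
  unfolding nsum_def ncs_coeff_Abs
  by (rule sum.mono_neutral_left) (use assms in \<open>auto simp: fil_def\<close>)

lemma nsum_approx:
  assumes "\<And>k. fil k (f k)"
  shows "fil n (nsum f - (\<Sum>k<n. f k))"
  using ncs_coeff_nsum[OF assms] by (auto simp: fil_def ncs_coeff_sum)

lemma nsum_eqI:
  assumes "\<And>k. fil k (f k)" "\<And>n. fil n (x - (\<Sum>k<n. f k))"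
  shows "x = nsum f"
  using nsum_approx[of f, OF assms(1)] assms(2) by (blast intro: fil_eqI fil_triangle fil_commute)

lemma fil_nsum: "(\<And>k. fil n (f k)) \<Longrightarrow> fil n (nsum f)"
  by (auto simp: fil_def nsum_def)

lemma nsum_diff: "nsum f - nsum g = nsum (\<lambda>k. f k - g k)"
  and nsum_minus: "- nsum f = nsum (\<lambda>k. - f k)"
  by (rule ncs_eqI; simp add: nsum_def sum_subtractf sum_negf)+

lemma nsum_shift:
  assumes "\<And>k. fil k (f k)"
  shows "nsum f = f 0 + nsum (\<lambda>k. f (Suc k))"
proof (rule ncs_eqI)
  fix w :: "'a list"
  have "ncs_coeff (f (Suc (length w))) w = 0"
    using assms[of "Suc (length w)"] by (simp add: fil_def)
  then have "(\<Sum>k\<le>length w. ncs_coeff (f (Suc k)) w) = (\<Sum>k<length w. ncs_coeff (f (Suc k)) w)"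
    by (simp flip: lessThan_Suc_atMost)
  then show "ncs_coeff (nsum f) w = ncs_coeff (f 0 + nsum (\<lambda>k. f (Suc k))) w"
    unfolding nsum_def
    by (simp add: sum.lessThan_Suc_shift del: sum.lessThan_Suc flip: lessThan_Suc_atMost)
qed

lemma nsum_single:
  assumes "\<And>k. k \<noteq> n \<Longrightarrow> f k = 0" "fil n (f n)"
  shows "nsum f = f n"
proof (rule ncs_eqI)
  fix w :: "'a list"
  have "(\<Sum>k\<le>length w. ncs_coeff (f k) w) = (\<Sum>k\<le>length w. if k = n then ncs_coeff (f n) w else 0)"
    by (intro sum.cong refl) (use assms(1) in auto)
  then show "ncs_coeff (nsum f) w = ncs_coeff (f n) w"
    using assms(2) by (simp add: nsum_def fil_def)
qed

lemma nsum_nsum: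
  assumes f: "\<And>i j. fil (i + j) (f i j)"
  shows "nsum (\<lambda>i. nsum (f i)) = nsum (\<lambda>n. \<Sum>i\<le>n. f i (n - i))"
proof (rule ncs_eqI)
  fix w :: "'a list"
  let ?c = "\<lambda>i j. ncs_coeff (f i j) w" and ?N = "length w"
  have z: "?c i j = 0" if "?N < i + j" for i j
    using f that by (auto simp: fil_def)
  have "(\<Sum>i\<le>?N. \<Sum>j\<le>?N. ?c i j) = (\<Sum>(i, j)\<in>{..?N} \<times> {..?N}. ?c i j)"
    by (simp add: sum.cartesian_product)
  also have "\<dots> = (\<Sum>(i, j)\<in>{(i, j). i + j \<le> ?N}. ?c i j)"
    by (rule sum.mono_neutral_right) (auto intro!: z)
  also have "\<dots> = (\<Sum>n\<le>?N. \<Sum>i\<le>n. ?c i (n - i))"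
    by (rule sum.triangle_reindex_eq)
  finally show "ncs_coeff (nsum (\<lambda>i. nsum (f i))) w = ncs_coeff (nsum (\<lambda>n. \<Sum>i\<le>n. f i (n - i))) w"
    by (simp add: nsum_def ncs_coeff_sum)
qed

lemma nsum_additive_vec:
  fixes \<phi> :: "('b \<Rightarrow> ('a, 'k::comm_ring_1) ncs) \<Rightarrow> ('c, 'l::comm_ring_1) ncs"
  assumes add: "\<And>u v. \<phi> (\<lambda>a. u a + v a) = \<phi> u + \<phi> v"
    and filtered: "\<And>n v. (\<And>a. fil n (v a)) \<Longrightarrow> fil n (\<phi> v)"
    and f: "\<And>k a. fil k (f k a)"
  shows "\<phi> (\<lambda>a. nsum (\<lambda>k. f k a)) = nsum (\<lambda>k. \<phi> (f k))"
proof (rule nsum_eqI)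
  show "fil k (\<phi> (f k))" for k by (intro filtered f)
  have zero: "\<phi> (\<lambda>a. 0) = 0" using add[of "\<lambda>a. 0" "\<lambda>a. 0"] by simp
  have sum: "\<phi> (\<lambda>a. \<Sum>k<n. f k a) = (\<Sum>k<n. \<phi> (f k))" for n
    by (induction n) (simp_all add: zero add)
  fix n
  have "\<phi> (\<lambda>a. nsum (\<lambda>k. f k a))
      = \<phi> (\<lambda>a. nsum (\<lambda>k. f k a) - (\<Sum>k<n. f k a)) + \<phi> (\<lambda>a. \<Sum>k<n. f k a)"
    by (subst add [symmetric]) simp
  moreover have "fil n (\<phi> (\<lambda>a. nsum (\<lambda>k. f k a) - (\<Sum>k<n. f k a)))"
    by (intro filtered nsum_approx f)
  ultimately show "fil n (\<phi> (\<lambda>a. nsum (\<lambda>k. f k a)) - (\<Sum>k<n. \<phi> (f k)))"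
    by (simp add: sum)
qed

lemma nsum_additive:
  fixes \<phi> :: "('a, 'k::comm_ring_1) ncs \<Rightarrow> ('c, 'l::comm_ring_1) ncs"
  assumes "\<And>x y. \<phi> (x + y) = \<phi> x + \<phi> y" "\<And>n x. fil n x \<Longrightarrow> fil n (\<phi> x)" "\<And>k. fil k (f k)"
  shows "\<phi> (nsum f) = nsum (\<lambda>k. \<phi> (f k))"
  by (rule nsum_additive_vec[of "\<lambda>v. \<phi> (v ())" "\<lambda>k _. f k"]) (use assms in auto)

lemma fil_mult_left: "fil n y \<Longrightarrow> fil n (x * y)"
  and fil_mult_right: "fil n x \<Longrightarrow> fil n (x * y)"
  using fil_mult[of 0 x n y] fil_mult[of n x 0 y] by simp_all

lemma nsum_scale: "ncs_scale c (nsum f) = nsum (\<lambda>k. ncs_scale c (f k))"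
  by (rule ncs_eqI) (simp add: nsum_def sum_distrib_left)

lemma nsum_mult:
  assumes "\<And>k. fil k (f k)" "\<And>k. fil k (g k)"
  shows "nsum f * nsum g = nsum (\<lambda>n. \<Sum>i\<le>n. f i * g (n - i))"
proof -
  have "nsum f * nsum g = nsum (\<lambda>i. f i * nsum g)"
    by (rule nsum_additive) (auto simp: distrib_right fil_mult_right assms)
  also have "\<dots> = nsum (\<lambda>i. nsum (\<lambda>j. f i * g j))"
    by (intro arg_cong[of _ _ nsum] ext nsum_additive) (auto simp: distrib_left fil_mult_left assms)
  also have "\<dots> = nsum (\<lambda>n. \<Sum>i\<le>n. f i * g (n - i))"
    by (intro nsum_nsum fil_mult assms)
  finally show ?thesis .
qed

lemma lie_simps:
  "lie (x + y) z = lie x z + lie y z" "lie x (y + z) = lie x y + lie x z"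
  "lie (x - y) z = lie x z - lie y z" "lie x (y - z) = lie x y - lie x z"
  "lie (- x) z = - lie x z" "lie x (- z) = - lie x z"
  "lie (ncs_scale c x) y = ncs_scale c (lie x y)" "lie x (ncs_scale c y) = ncs_scale c (lie x y)"
  by (simp_all add: lie_def algebra_simps ncs_scale_mult ncs.scale_right_diff_distrib)


section \<open>Power series in operators\<close>

lemma fps_const_sum: "fps_const (sum f A) = (\<Sum>i\<in>A. fps_const (f i))"
  by (induction A rule: infinite_finite_induct) (auto simp flip: fps_const_add)

locale filtered_op =
  fixes T :: "('a \<Rightarrow> ('a, rat fps) ncs) \<Rightarrow> 'a \<Rightarrow> ('a, rat fps) ncs"
  assumes op_add: "T (\<lambda>a. u a + v a) = (\<lambda>a. T u a + T v a)"
    and op_scale: "T (\<lambda>a. ncs_scale c (u a)) = (\<lambda>a. ncs_scale c (T u a))"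
    and op_raise: "(\<And>a. fil m (v a)) \<Longrightarrow> fil (Suc m) (T v a)"
begin

lemma pow_add: "(T ^^ k) (\<lambda>a. u a + v a) = (\<lambda>a. (T ^^ k) u a + (T ^^ k) v a)"
  by (induction k) (auto simp: op_add)

lemma pow_scale: "(T ^^ k) (\<lambda>a. ncs_scale c (u a)) = (\<lambda>a. ncs_scale c ((T ^^ k) u a))"
  by (induction k) (auto simp: op_scale)

lemma pow_raise: "(\<And>a. fil m (v a)) \<Longrightarrow> fil (m + k) ((T ^^ k) v a)"
  by (induction k arbitrary: a) (auto intro: op_raise)

lemma pow_fil: "fil k ((T ^^ k) v a)"
  using pow_raise[of 0] by simp

lemma pow_filtered: "(\<And>a. fil m (v a)) \<Longrightarrow> fil m ((T ^^ k) v a)"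
  by (rule fil_mono[OF pow_raise]) auto

lemma op_series_vec_nsum:
  "op_series_vec F T v a = nsum (\<lambda>k. ncs_scale (fps_const (fps_nth F k)) ((T ^^ k) v a))"
proof (rule ncs_eqI)
  fix w
  have "k \<le> length w" if "ncs_coeff ((T ^^ k) v a) w \<noteq> 0" for k
    using pow_fil[of k v a] that by (force simp: fil_def)
  then show "ncs_coeff (op_series_vec F T v a) w
      = ncs_coeff (nsum (\<lambda>k. ncs_scale (fps_const (fps_nth F k)) ((T ^^ k) v a))) w"
    unfolding op_series_vec_def nsum_def ncs_coeff_Abs ncs_coeff_more
    by (intro Sum_any.expand_superset) auto
qed

lemma op_series_vec_comp:
  "op_series_vec F T (op_series_vec G T v) a = op_series_vec (F * G) T v a"
proof -
  let ?g = "\<lambda>k. ncs_scale (fps_const (fps_nth G k))" and ?f = "\<lambda>k. ncs_scale (fps_const (fps_nth F k))"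
  have G: "op_series_vec G T v = (\<lambda>a. nsum (\<lambda>j. ?g j ((T ^^ j) v a)))"
    by (rule ext) (rule op_series_vec_nsum)
  have "op_series_vec F T (op_series_vec G T v) a
      = nsum (\<lambda>i. ?f i ((T ^^ i) (\<lambda>a. nsum (\<lambda>j. ?g j ((T ^^ j) v a))) a))"
    unfolding op_series_vec_nsum[of F] G ..
  also have "\<dots> = nsum (\<lambda>i. nsum (\<lambda>j. ?f i (?g j ((T ^^ (i + j)) v a))))"
  proof (intro arg_cong[of _ _ nsum] ext)
    fix i
    have "(T ^^ i) (\<lambda>a. nsum (\<lambda>j. ?g j ((T ^^ j) v a))) a
        = nsum (\<lambda>j. (T ^^ i) (\<lambda>a. ?g j ((T ^^ j) v a)) a)"
      by (rule nsum_additive_vec[of "\<lambda>v. (T ^^ i) v a"])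
        (auto simp: pow_add intro: fil_scale pow_fil pow_filtered)
    then show "?f i ((T ^^ i) (\<lambda>a. nsum (\<lambda>j. ?g j ((T ^^ j) v a))) a)
        = nsum (\<lambda>j. ?f i (?g j ((T ^^ (i + j)) v a)))"
      by (simp add: nsum_scale pow_scale funpow_add)
  qed
  also have "\<dots> = nsum (\<lambda>n. \<Sum>i\<le>n. ?f i (?g (n - i) ((T ^^ (i + (n - i))) v a)))"
    by (rule nsum_nsum) (intro fil_scale pow_fil)
  also have "\<dots> = op_series_vec (F * G) T v a"
    unfolding op_series_vec_nsum
    by (simp add: fps_mult_nth ncs.scale_sum_left atLeast0AtMost fps_const_sum
      flip: fps_const_mult)
  finally show ?thesis .
qed

lemma op_series_vec_1: "op_series_vec 1 T v a = v a"
proof -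
  have "op_series_vec 1 T v a = ncs_scale (fps_const (fps_nth 1 0)) ((T ^^ 0) v a)"
    unfolding op_series_vec_nsum by (rule nsum_single) auto
  then show ?thesis by simp
qed

end

locale filtered_endo =
  fixes T :: "('a, rat fps) ncs \<Rightarrow> ('a, rat fps) ncs"
  assumes T_add: "T (x + y) = T x + T y"
    and T_scale: "T (ncs_scale c x) = ncs_scale c (T x)"
    and T_raise: "fil m x \<Longrightarrow> fil (Suc m) (T x)"
begin

sublocale lift: filtered_op "\<lambda>v (_ :: 'a). T (v undefined)"
  by standard (auto simp: T_add T_scale intro: T_raise)

lemma lift_pow: "((\<lambda>(v :: 'a \<Rightarrow> _) (_ :: 'a). T (v undefined)) ^^ k) (\<lambda>_. x) = (\<lambda>_. (T ^^ k) x)"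
  by (induction k) auto

lemma op_series_lift: "op_series F T x = op_series_vec F (\<lambda>v (_ :: 'a). T (v undefined)) (\<lambda>_. x) a"
  unfolding op_series_def op_series_vec_def lift_pow ..

lemma op_series_nsum:
  "op_series F T x = nsum (\<lambda>k. ncs_scale (fps_const (fps_nth F k)) ((T ^^ k) x))"
  unfolding op_series_lift[where a = undefined] lift.op_series_vec_nsum lift_pow ..

lemma op_series_comp: "op_series F T (op_series G T x) = op_series (F * G) T x"
proof -
  have "(\<lambda>_. op_series G T x) = op_series_vec G (\<lambda>v (_ :: 'a). T (v undefined)) (\<lambda>_. x)"
    by (rule ext) (rule op_series_lift)
  then show ?thesis
    by (simp add: op_series_lift[where a = undefined and F = F]
        op_series_lift[where a = undefined and F = "F * G"] lift.op_series_vec_comp)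
qed

lemma op_series_1: "op_series 1 T x = x"
  by (simp add: op_series_lift[where a = undefined] lift.op_series_vec_1)

lemma Tpow_add: "(T ^^ k) (x + y) = (T ^^ k) x + (T ^^ k) y"
  by (induction k) (auto simp: T_add)

lemma Tpow_scale: "(T ^^ k) (ncs_scale c x) = ncs_scale c ((T ^^ k) x)"
  by (induction k) (auto simp: T_scale)

lemma Tpow_raise: "fil m x \<Longrightarrow> fil (m + k) ((T ^^ k) x)"
  by (induction k) (auto intro: T_raise)

lemma Tpow_fil: "fil k ((T ^^ k) x)"
  using Tpow_raise[of 0] by simp

lemma T_0: "T 0 = 0"
  using T_add[of 0 0] by simp

lemma T_sum: "T (sum f A) = (\<Sum>i\<in>A. T (f i))"
  by (induction A rule: infinite_finite_induct) (auto simp: T_add T_0)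

lemma op_series_add: "op_series F T (x + y) = op_series F T x + op_series F T y"
  unfolding op_series_nsum Tpow_add ncs.scale_right_distrib
  by (rule ncs_eqI) (simp add: nsum_def sum.distrib)

lemma op_series_scale: "op_series F T (ncs_scale c x) = ncs_scale c (op_series F T x)"
  unfolding op_series_nsum nsum_scale Tpow_scale by (simp add: mult.commute)

lemma op_series_filtered: "fil n x \<Longrightarrow> fil n (op_series F T x)"
  unfolding op_series_nsum using Tpow_raise[of n x]
  by (intro fil_nsum fil_scale) (rule fil_mono, auto)

lemma filtered_endo_neg: "filtered_endo (\<lambda>x. - T x)"
  by standard (auto simp: T_add T_scale intro: T_raise fil_minus)

interpretation neg: filtered_endo "\<lambda>x. - T x"
  by (rule filtered_endo_neg)

lemma neg_pow: "((\<lambda>x. - T x) ^^ k) x = ncs_scale (fps_const ((- 1) ^ k)) ((T ^^ k) x)"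
  by (induction k) (simp_all add: T_scale flip: fps_const_neg)

lemma op_exp_neg: "op_exp (\<lambda>x. - T x) x = op_series (fps_exp (- 1)) T x"
  unfolding neg.op_series_nsum op_series_nsum neg_pow by simp

lemma op_exp_neg_inverse:
  "op_exp T (op_exp (\<lambda>x. - T x) x) = x" "op_exp (\<lambda>x. - T x) (op_exp T x) = x"
  unfolding op_exp_neg op_series_comp fps_exp_add_mult[symmetric] by (simp_all add: op_series_1)

lemma pow_binomial:
  assumes step: "\<And>i j. T (f i j) = f (Suc i) j + f i (Suc j)"
  shows "(T ^^ n) (f 0 0) = (\<Sum>k\<le>n. ncs_scale (of_nat (n choose k)) (f k (n - k)))"
proof (induction n)
  case (Suc n)
  let ?s = "\<lambda>m. ncs_scale (of_nat m)"
  have "(T ^^ Suc n) (f 0 0) = (\<Sum>k\<le>n. T (?s (n choose k) (f k (n - k))))"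
    by (simp add: Suc T_sum)
  also have "\<dots> = (\<Sum>k\<le>n. ?s (n choose k) (f (Suc k) (n - k)))
      + (\<Sum>k\<le>n. ?s (n choose k) (f k (Suc n - k)))"
    unfolding sum.distrib[symmetric]
    by (intro sum.cong refl) (simp add: T_scale step ncs.scale_right_distrib Suc_diff_le)
  also have "(\<Sum>k\<le>n. ?s (n choose k) (f k (Suc n - k)))
      = (\<Sum>k\<le>Suc n. ?s (n choose k) (f k (Suc n - k)))"
    by (simp add: binomial_eq_0)
  also have "\<dots> = f 0 (Suc n) + (\<Sum>k\<le>n. ?s (n choose Suc k) (f (Suc k) (n - k)))"
    by (subst sum.atMost_Suc_shift) simp
  also have "(\<Sum>k\<le>n. ?s (n choose k) (f (Suc k) (n - k))) + \<dots>
      = f 0 (Suc n) + (\<Sum>k\<le>n. ?s (Suc n choose Suc k) (f (Suc k) (n - k)))"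
    by (simp add: sum.distrib ncs.scale_left_distrib algebra_simps)
  also have "\<dots> = (\<Sum>k\<le>Suc n. ?s (Suc n choose k) (f k (Suc n - k)))"
    by (subst sum.atMost_Suc_shift) simp
  finally show ?case .
qed simp

lemma op_exp_binomial:
  assumes step: "\<And>i j. T (f i j) = f (Suc i) j + f i (Suc j)" and f: "\<And>i j. fil (i + j) (f i j)"
  shows "op_exp T (f 0 0)
    = nsum (\<lambda>i. nsum (\<lambda>j. ncs_scale (fps_const (1 / (fact i * fact j))) (f i j)))"
proof -
  have "ncs_scale (fps_const (fps_nth (fps_exp 1) n)) ((T ^^ n) (f 0 0))
      = (\<Sum>i\<le>n. ncs_scale (fps_const (1 / (fact i * fact (n - i)))) (f i (n - i)))" for n
  proof -
    have "(1 / fact n :: rat) * of_nat (n choose k) = 1 / (fact k * fact (n - k))" if "k \<le> n" for k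
      by (simp add: binomial_fact[OF that])
    then show ?thesis
      unfolding pow_binomial[of f, OF step] ncs.scale_sum_right
      by (intro sum.cong refl) (simp flip: fps_of_nat)
  qed
  then show ?thesis
    unfolding op_series_nsum by (simp add: nsum_nsum fil_scale f)
qed

lemma op_exp_mult:
  assumes "\<And>x y. T (x * y) = T x * y + x * T y"
  shows "op_exp T (x * y) = op_exp T x * op_exp T y"
proof -
  let ?f = "\<lambda>i j. (T ^^ i) x * (T ^^ j) y" and ?e = "\<lambda>k. ncs_scale (fps_const (1 / fact k))"
  have "op_exp T (?f 0 0)
    = nsum (\<lambda>i. nsum (\<lambda>j. ncs_scale (fps_const (1 / (fact i * fact j))) (?f i j)))"
    by (rule op_exp_binomial) (auto simp: assms intro: fil_mult Tpow_fil)
  also have "\<dots> = nsum (\<lambda>i. nsum (\<lambda>j. ?e i ((T ^^ i) x) * ?e j ((T ^^ j) y)))"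
    by (simp add: ncs_scale_mult mult.commute)
  also have "\<dots> = nsum (\<lambda>n. \<Sum>i\<le>n. ?e i ((T ^^ i) x) * ?e (n - i) ((T ^^ (n - i)) y))"
    by (intro nsum_nsum fil_mult fil_scale Tpow_fil)
  also have "\<dots> = op_exp T x * op_exp T y"
    unfolding op_series_nsum by (subst nsum_mult) (auto intro: fil_scale Tpow_fil)
  finally show ?thesis by simp
qed

text \<open>
  With \<open>A k = (ad T)\<^sup>k (A 0)\<close> this is \<open>e\<^sup>T \<circ> A 0 = e\<^bsup>ad T\<^esup>(A 0) \<circ> e\<^sup>T\<close>. It is applied
  to \<open>A 0 = d/dt\<close>, for which \<open>ad T (A 0)\<close> is minus the derivative of \<open>T\<close>.
\<close>

lemma op_exp_commute:
  assumes M: "\<And>x. x \<in> M \<Longrightarrow> T x \<in> M" "x \<in> M"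
    and A_add: "\<And>k x y. A k (x + y) = A k x + A k y"
    and A_scale: "\<And>k c x. A k (ncs_scale (fps_const c) x) = ncs_scale (fps_const c) (A k x)"
    and A_raise: "\<And>k m x. fil m x \<Longrightarrow> fil (k + m) (A k x)"
    and comm: "\<And>k x. x \<in> M \<Longrightarrow> T (A k x) = A (Suc k) x + A k (T x)"
  shows "op_exp T (A 0 x) = nsum (\<lambda>k. ncs_scale (fps_const (1 / fact k)) (A k (op_exp T x)))"
proof -
  let ?f = "\<lambda>i j. A i ((T ^^ j) x)" and ?e = "\<lambda>k. ncs_scale (fps_const (1 / fact k))"
  have pow_M: "(T ^^ j) x \<in> M" for j by (induction j) (auto intro: M)
  have "op_exp T (?f 0 0)
    = nsum (\<lambda>i. nsum (\<lambda>j. ncs_scale (fps_const (1 / (fact i * fact j))) (?f i j)))"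
    by (rule op_exp_binomial) (auto simp: comm pow_M intro: A_raise Tpow_fil)
  also have "\<dots> = nsum (\<lambda>i. ?e i (nsum (\<lambda>j. A i (?e j ((T ^^ j) x)))))"
    by (simp add: nsum_scale A_scale)
  also have "\<dots> = nsum (\<lambda>i. ?e i (A i (op_exp T x)))"
  proof (intro arg_cong[of _ _ nsum] ext arg_cong[of _ _ "?e _"])
    fix i
    have "A i (nsum (\<lambda>j. ?e j ((T ^^ j) x))) = nsum (\<lambda>j. A i (?e j ((T ^^ j) x)))"
      by (rule nsum_additive) (auto simp: A_add intro: fil_scale Tpow_fil fil_mono[OF A_raise])
    then show "nsum (\<lambda>j. A i (?e j ((T ^^ j) x))) = A i (op_exp T x)"
      unfolding op_series_nsum by simp
  qed
  finally show ?thesis by simp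
qed

end

section \<open>Derivations of the algebra of noncommutative series\<close>

definition lquot :: "'a \<Rightarrow> ('a, 'k) ncs \<Rightarrow> ('a, 'k) ncs" where
  "lquot a x = Abs_ncs (\<lambda>w. ncs_coeff x (a # w))"

lemma ncs_coeff_lquot [simp]: "ncs_coeff (lquot a x) w = ncs_coeff x (a # w)"
  by (simp add: lquot_def)

lemma lquot_simps [simp]:
  "lquot a 0 = 0" "lquot a 1 = 0"
  "lquot a (x + y) = lquot a x + lquot a y"
  "lquot a (ncs_scale c x) = ncs_scale c (lquot a x)"
  by (rule ncs_eqI; simp)+

lemma lquot_letter: "lquot a (letter b) = (if a = b then 1 else 0)"
  by (rule ncs_eqI) auto

lemma lquot_mult: "lquot a (x * y) = lquot a x * y + ncs_scale (ncs_coeff x []) (lquot a y)"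
proof (rule ncs_eqI)
  fix w
  have "ncs_coeff (x * y) (a # w)
      = (\<Sum>i\<le>Suc (length w). ncs_coeff x (take i (a # w)) * ncs_coeff y (drop i (a # w)))"
    by (simp add: ncs_coeff_mult atLeast0AtMost)
  also have "\<dots> = ncs_coeff x [] * ncs_coeff y (a # w)
      + (\<Sum>i\<le>length w. ncs_coeff (lquot a x) (take i w) * ncs_coeff y (drop i w))"
    by (subst sum.atMost_Suc_shift) simp
  finally show "ncs_coeff (lquot a (x * y)) w
      = ncs_coeff (lquot a x * y + ncs_scale (ncs_coeff x []) (lquot a y)) w"
    by (simp add: ncs_coeff_mult atLeast0AtMost)
qed

lemma ncs_coeff_mult_Nil: "ncs_coeff (x * y) [] = ncs_coeff x [] * ncs_coeff y []"
  by (simp add: ncs_coeff_mult)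

lemma fil_lquot: "fil n x \<Longrightarrow> fil (n - 1) (lquot a x)"
  by (auto simp: fil_def)

text \<open>
  The derivation that maps each letter \<open>a \<in> S\<close> to \<open>g a\<close> and every other letter to \<open>0\<close>, computed
  from \<open>x = x\<^sub>\<emptyset> + (\<Sum>a. a \<cdot> lquot a x)\<close>: the Leibniz rule replaces the first letter by its image or
  differentiates the quotient.
\<close>

definition dhead :: "'a set \<Rightarrow> ('a \<Rightarrow> ('a, 'k::comm_ring_1) ncs) \<Rightarrow> ('a, 'k) ncs \<Rightarrow> ('a, 'k) ncs" where
  "dhead S g x = (\<Sum>a\<in>S. g a * lquot a x)"

primrec dcoeff ::
  "'a set \<Rightarrow> ('a \<Rightarrow> ('a, 'k::comm_ring_1) ncs) \<Rightarrow> 'a list \<Rightarrow> ('a, 'k) ncs \<Rightarrow> 'k" where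
  "dcoeff S g [] x = ncs_coeff (dhead S g x) []"
| "dcoeff S g (b # w) x = ncs_coeff (dhead S g x) (b # w) + dcoeff S g w (lquot b x)"

definition deriv_ncs ::
  "'a set \<Rightarrow> ('a \<Rightarrow> ('a, 'k::comm_ring_1) ncs) \<Rightarrow> ('a, 'k) ncs \<Rightarrow> ('a, 'k) ncs" where
  "deriv_ncs S g x = Abs_ncs (\<lambda>w. dcoeff S g w x)"

lemma ncs_coeff_deriv_ncs:
  "ncs_coeff (deriv_ncs S g x) [] = ncs_coeff (dhead S g x) []"
  "ncs_coeff (deriv_ncs S g x) (b # w)
    = ncs_coeff (dhead S g x) (b # w) + ncs_coeff (deriv_ncs S g (lquot b x)) w"
  by (simp_all add: deriv_ncs_def)

lemma lquot_deriv_ncs: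
  "lquot b (deriv_ncs S g x) = lquot b (dhead S g x) + deriv_ncs S g (lquot b x)"
  by (rule ncs_eqI) (simp add: ncs_coeff_deriv_ncs)

lemma dhead_simps:
  "dhead S g (x + y) = dhead S g x + dhead S g y"
  "dhead S g (ncs_scale c x) = ncs_scale c (dhead S g x)"
  "dhead S (\<lambda>a. g a + h a) x = dhead S g x + dhead S h x"
  "dhead S (\<lambda>a. ncs_scale c (g a)) x = ncs_scale c (dhead S g x)"
  by (simp_all add: dhead_def algebra_simps sum.distrib ncs_scale_mult ncs.scale_sum_right)

lemma deriv_ncs_add: "deriv_ncs S g (x + y) = deriv_ncs S g x + deriv_ncs S g y"
proof (rule ncs_eqI)
  show "ncs_coeff (deriv_ncs S g (x + y)) w = ncs_coeff (deriv_ncs S g x + deriv_ncs S g y) w" for w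
    by (induction w arbitrary: x y) (simp_all add: ncs_coeff_deriv_ncs dhead_simps)
qed

lemma deriv_ncs_scale: "deriv_ncs S g (ncs_scale c x) = ncs_scale c (deriv_ncs S g x)"
proof (rule ncs_eqI)
  show "ncs_coeff (deriv_ncs S g (ncs_scale c x)) w = ncs_coeff (ncs_scale c (deriv_ncs S g x)) w" for w
    by (induction w arbitrary: x) (simp_all add: ncs_coeff_deriv_ncs dhead_simps algebra_simps)
qed

lemma deriv_ncs_add_left: "deriv_ncs S (\<lambda>a. g a + h a) x = deriv_ncs S g x + deriv_ncs S h x"
proof (rule ncs_eqI)
  show "ncs_coeff (deriv_ncs S (\<lambda>a. g a + h a) x) w
      = ncs_coeff (deriv_ncs S g x + deriv_ncs S h x) w" for w
    by (induction w arbitrary: x) (simp_all add: ncs_coeff_deriv_ncs dhead_simps)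
qed

lemma deriv_ncs_scale_left:
  "deriv_ncs S (\<lambda>a. ncs_scale c (g a)) x = ncs_scale c (deriv_ncs S g x)"
proof (rule ncs_eqI)
  show "ncs_coeff (deriv_ncs S (\<lambda>a. ncs_scale c (g a)) x) w
      = ncs_coeff (ncs_scale c (deriv_ncs S g x)) w" for w
    by (induction w arbitrary: x) (simp_all add: ncs_coeff_deriv_ncs dhead_simps algebra_simps)
qed

lemma deriv_ncs_mult: "deriv_ncs S g (x * y) = deriv_ncs S g x * y + x * deriv_ncs S g y"
proof (rule ncs_eqI)
  have head: "dhead S g (x * y) = dhead S g x * y + ncs_scale (ncs_coeff x []) (dhead S g y)"
    for x y
    by (simp add: dhead_def lquot_mult distrib_left sum.distrib sum_distrib_right mult.assoc
        ncs_scale_mult ncs.scale_sum_right)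
  show "ncs_coeff (deriv_ncs S g (x * y)) w
      = ncs_coeff (deriv_ncs S g x * y + x * deriv_ncs S g y) w" for w
  proof (induction w arbitrary: x y)
    case Nil
    then show ?case by (simp add: ncs_coeff_deriv_ncs head ncs_coeff_mult_Nil)
  next
    case (Cons b w)
    have "lquot b (dhead S g (x * y)) = lquot b (dhead S g x) * y
        + ncs_scale (ncs_coeff (dhead S g x) []) (lquot b y)
        + ncs_scale (ncs_coeff x []) (lquot b (dhead S g y))"
      by (simp add: head lquot_mult)
    moreover have "ncs_coeff (deriv_ncs S g (lquot b (x * y))) w
        = ncs_coeff (deriv_ncs S g (lquot b x) * y + lquot b x * deriv_ncs S g y
            + ncs_scale (ncs_coeff x []) (deriv_ncs S g (lquot b y))) w"
      by (simp add: lquot_mult deriv_ncs_add deriv_ncs_scale Cons)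
    ultimately have "ncs_coeff (lquot b (deriv_ncs S g (x * y))) w
      = ncs_coeff (lquot b (deriv_ncs S g x * y + x * deriv_ncs S g y)) w"
      by (simp add: lquot_deriv_ncs lquot_mult algebra_simps ncs_coeff_deriv_ncs(1)
          del: ncs_coeff_lquot)
    then show ?case by simp
  qed
qed

lemma dhead_0 [simp]: "dhead S g 0 = 0"
  by (simp add: dhead_def)

lemma deriv_ncs_letter:
  assumes "finite S" "a \<in> S"
  shows "deriv_ncs S g (letter a) = g a"
proof -
  have head: "dhead S g (letter a) = g a"
  proof -
    have "dhead S g (letter a) = (\<Sum>b\<in>S. if a = b then g b else 0)"
      unfolding dhead_def by (intro sum.cong refl) (simp add: lquot_letter)
    then show ?thesis using assms by simp
  qed
  have zero: "deriv_ncs S g 0 = 0"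
    using deriv_ncs_add[of S g 0 0] by simp
  have "deriv_ncs S g 1 = 0"
    using deriv_ncs_mult[of S g 1 1] by simp
  then show ?thesis
    by (intro ncs_eqI) (case_tac w, auto simp: ncs_coeff_deriv_ncs head lquot_letter zero)
qed

lemma fil_deriv_ncs:
  assumes "\<And>a. fil (Suc k) (g a)" "fil m x"
  shows "fil (m + k) (deriv_ncs S g x)"
proof -
  have head: "fil (m + k) (dhead S g x)" if "fil m x" for m x
    unfolding dhead_def
  proof (intro fil_sum)
    fix a
    have "fil (Suc k + (m - 1)) (g a * lquot a x)"
      by (intro fil_mult assms fil_lquot that)
    then show "fil (m + k) (g a * lquot a x)" by (rule fil_mono) simp
  qed
  have "ncs_coeff (deriv_ncs S g x) w = 0" if "length w < m + k" for w
    using that assms(2)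
  proof (induction w arbitrary: m x)
    case Nil
    then show ?case using head[of m x] by (simp add: ncs_coeff_deriv_ncs fil_def)
  next
    case (Cons b w)
    then have "ncs_coeff (deriv_ncs S g (lquot b x)) w = 0"
      by (intro Cons.IH[of "m - 1"] fil_lquot) auto
    then show ?case using head[of m x] Cons by (simp add: ncs_coeff_deriv_ncs fil_def)
  qed
  then show ?thesis by (simp add: fil_def)
qed


section \<open>Tangential derivations\<close>

definition tder_ncs ::
  "'a set \<Rightarrow> ('a \<Rightarrow> ('a, 'k::comm_ring_1) ncs) \<Rightarrow> ('a, 'k) ncs \<Rightarrow> ('a, 'k) ncs" where
  "tder_ncs S v = deriv_ncs S (\<lambda>a. lie (letter a) (v a))"

definition tb_ncs ::
  "'a set \<Rightarrow> ('a \<Rightarrow> ('a, 'k::comm_ring_1) ncs) \<Rightarrow> ('a \<Rightarrow> ('a, 'k) ncs) \<Rightarrow> 'a \<Rightarrow> ('a, 'k) ncs" where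
  "tb_ncs S u v = (\<lambda>a. lie (u a) (v a) + tder_ncs S u (v a) - tder_ncs S v (u a))"

lemma tder_ncs_add: "tder_ncs S v (x + y) = tder_ncs S v x + tder_ncs S v y"
  and tder_ncs_scale: "tder_ncs S v (ncs_scale c x) = ncs_scale c (tder_ncs S v x)"
  and tder_ncs_mult: "tder_ncs S v (x * y) = tder_ncs S v x * y + x * tder_ncs S v y"
  by (simp_all add: tder_ncs_def deriv_ncs_add deriv_ncs_scale deriv_ncs_mult)

lemma tder_ncs_0 [simp]: "tder_ncs S v 0 = 0"
  using tder_ncs_add[of S v 0 0] by simp

lemma tder_ncs_minus: "tder_ncs S v (- x) = - tder_ncs S v x"
  using tder_ncs_add[of S v x "- x"] by (simp add: eq_neg_iff_add_eq_0 add.commute)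

lemma tder_ncs_diff: "tder_ncs S v (x - y) = tder_ncs S v x - tder_ncs S v y"
  using tder_ncs_add[of S v x "- y"] by (simp add: tder_ncs_minus)

lemma tder_ncs_lie: "tder_ncs S v (lie x y) = lie (tder_ncs S v x) y + lie x (tder_ncs S v y)"
  by (simp add: lie_def tder_ncs_diff tder_ncs_mult)

lemma tder_ncs_letter:
  "finite S \<Longrightarrow> a \<in> S \<Longrightarrow> tder_ncs S v (letter a) = lie (letter a) (v a)"
  by (simp add: tder_ncs_def deriv_ncs_letter)

lemma tder_ncs_add_left: "tder_ncs S (\<lambda>a. u a + v a) x = tder_ncs S u x + tder_ncs S v x"
  and tder_ncs_scale_left: "tder_ncs S (\<lambda>a. ncs_scale c (v a)) x = ncs_scale c (tder_ncs S v x)"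
  by (simp_all add: tder_ncs_def lie_simps deriv_ncs_add_left deriv_ncs_scale_left)

lemma tder_ncs_diff_left: "tder_ncs S (\<lambda>a. u a - v a) x = tder_ncs S u x - tder_ncs S v x"
  using tder_ncs_add_left[of S "\<lambda>a. u a - v a" v x] by (simp add: algebra_simps)

lemma fil_letter: "fil 1 (letter a)"
  by (simp add: fil_def)

lemma fil_tder_ncs:
  assumes "\<And>a. fil k (v a)" "fil m x"
  shows "fil (m + k) (tder_ncs S v x)"
  unfolding tder_ncs_def using fil_lie[OF fil_letter assms(1)]
  by (intro fil_deriv_ncs assms(2)) simp

lemma filtered_endo_tder_ncs:
  assumes "\<And>a. fil 1 (v a)"
  shows "filtered_endo (tder_ncs S v)"
  using fil_tder_ncs[of 1 v, OF assms] by (unfold_locales) (simp_all add: tder_ncs_add tder_ncs_scale)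

lemma fil_tb_ncs:
  assumes "\<And>a. fil k (u a)" "\<And>a. fil m (v a)"
  shows "fil (k + m) (tb_ncs S u v a)"
  unfolding tb_ncs_def
  using fil_tder_ncs[of k u m "v a" S] fil_tder_ncs[of m v k "u a" S] assms
  by (intro fil_add fil_diff fil_lie) (auto simp: add.commute)

lemma filtered_op_tb_ncs:
  assumes "\<And>a. fil 1 (u a)"
  shows "filtered_op (tb_ncs S u)"
proof
  show "fil (Suc m) (tb_ncs S u v a)" if "\<And>a. fil m (v a)" for m v a
    using fil_tb_ncs[of 1 u m v S a] assms that by simp
qed (simp_all add: tb_ncs_def lie_simps tder_ncs_add tder_ncs_scale tder_ncs_add_left
    tder_ncs_scale_left ncs.scale_right_distrib ncs.scale_right_diff_distrib algebra_simps)

section \<open>The completed free Lie algebra\<close>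

lemma lie_poly_sum: "(\<And>i. i \<in> A \<Longrightarrow> f i \<in> lie_poly S) \<Longrightarrow> sum f A \<in> lie_poly S"
  by (induction A rule: infinite_finite_induct) (auto intro: lie_poly.intros)

lemma FL_zero: "0 \<in> FL S"
  and FL_letter: "a \<in> S \<Longrightarrow> letter a \<in> FL S"
  and FL_add: "x \<in> FL S \<Longrightarrow> y \<in> FL S \<Longrightarrow> x + y \<in> FL S"
  and FL_scale: "x \<in> FL S \<Longrightarrow> ncs_scale c x \<in> FL S"
  and FL_lie: "x \<in> FL S \<Longrightarrow> y \<in> FL S \<Longrightarrow> lie x y \<in> FL S"
  by (auto simp: FL_def hom_part_simps hom_part_lie intro!: lie_poly_sum intro: lie_poly.intros)

lemma FL_minus: "x \<in> FL S \<Longrightarrow> - x \<in> FL S"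
  using FL_scale[of x S "- 1"] by simp

lemma FL_diff: "x \<in> FL S \<Longrightarrow> y \<in> FL S \<Longrightarrow> x - y \<in> FL S"
  using FL_add[of x S "- y"] FL_minus[of y S] by simp

lemma FL_sum: "(\<And>i. i \<in> A \<Longrightarrow> f i \<in> FL S) \<Longrightarrow> sum f A \<in> FL S"
  by (induction A rule: infinite_finite_induct) (auto intro: FL_add FL_zero)

lemma fil_FL: "x \<in> FL S \<Longrightarrow> fil 1 x"
proof -
  assume "x \<in> FL S"
  then have "hom_part 0 (hom_part 0 x) = 0"
    by (intro hom_part_0_lie_poly[of _ S]) (auto simp: FL_def)
  then have "ncs_coeff (hom_part 0 (hom_part 0 x)) [] = 0" by simp
  then show ?thesis by (simp add: fil_def)
qed

lemma FL_limit:
  assumes "\<And>n. \<exists>y\<in>FL S. fil n (x - y)"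
  shows "x \<in> FL S"
  unfolding FL_def
proof (intro CollectI allI)
  fix n
  obtain y where "y \<in> FL S" "fil (Suc n) (x - y)" using assms by blast
  then show "hom_part n x \<in> lie_poly S" by (auto simp: fil_diff_iff FL_def)
qed

lemma FL_nsum: "(\<And>k. fil k (f k)) \<Longrightarrow> (\<And>k. f k \<in> FL S) \<Longrightarrow> nsum f \<in> FL S"
  by (rule FL_limit) (meson nsum_approx FL_sum)

lemma FL_approx:
  assumes "x \<in> FL S"
  obtains y where "y \<in> lie_poly S" "fil n (x - y)"
proof
  show "(\<Sum>i<n. hom_part i x) \<in> lie_poly S"
    using assms by (intro lie_poly_sum) (auto simp: FL_def)
  show "fil n (x - (\<Sum>i<n. hom_part i x))"
    by (auto simp: fil_def ncs_coeff_sum)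
qed

lemma vanishes_on_FL:
  assumes "x \<in> FL S"
    and add: "\<And>x y. \<theta> (x + y) = \<theta> x + \<theta> y" and filtered: "\<And>n x. fil n x \<Longrightarrow> fil n (\<theta> x)"
    and zero: "\<And>x. x \<in> lie_poly S \<Longrightarrow> \<theta> x = 0"
  shows "\<theta> x = 0"
proof (rule fil_eqI)
  fix n
  obtain y where "y \<in> lie_poly S" "fil n (x - y)" using FL_approx assms(1) .
  then have "fil n (\<theta> (x - y) + \<theta> y)" using zero filtered by simp
  then show "fil n (\<theta> x - 0)" by (simp flip: add)
qed

lemma continuous_eq_on_FL:
  assumes cont: "continuous_FL S F" "continuous_FL S G"
    and eq: "\<And>x. x \<in> lie_poly S \<Longrightarrow> F x = G x" and x: "x \<in> FL S"
  shows "F x = G x"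
proof (rule fil_eqI)
  fix n
  obtain m1 where m1: "\<And>x y. x \<in> FL S \<Longrightarrow> y \<in> FL S \<Longrightarrow> fil m1 (x - y) \<Longrightarrow> fil n (F x - F y)"
    using cont(1) unfolding continuous_FL_def fil_diff_iff by metis
  obtain m2 where m2: "\<And>x y. x \<in> FL S \<Longrightarrow> y \<in> FL S \<Longrightarrow> fil m2 (x - y) \<Longrightarrow> fil n (G x - G y)"
    using cont(2) unfolding continuous_FL_def fil_diff_iff by metis
  obtain y where y: "y \<in> lie_poly S" "fil (max m1 m2) (x - y)" using FL_approx x .
  then have yFL: "y \<in> FL S" using lie_poly_subset_FL by blast
  have "fil n (F x - F y)" "fil n (G x - G y)"
    using y by (auto intro!: m1 m2 x yFL elim: fil_mono)
  then show "fil n (F x - G x)"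
    unfolding eq[OF y(1)] by (blast intro: fil_triangle fil_commute)
qed

lemma linear_FL_lie_poly_eqI:
  fixes F G :: "('a, 'k::comm_ring_1) ncs \<Rightarrow> ('a, 'k) ncs"
  assumes lin: "linear_FL S F" "linear_FL S G"
    and letter: "\<And>a. a \<in> S \<Longrightarrow> F (letter a) = G (letter a)"
    and lie: "\<And>x y. \<lbrakk>x \<in> FL S; y \<in> FL S; F x = G x; F y = G y\<rbrakk> \<Longrightarrow> F (lie x y) = G (lie x y)"
    and "x \<in> lie_poly S"
  shows "F x = G x"
proof -
  have sub: "x \<in> FL S" if "x \<in> lie_poly S" for x :: "('a, 'k) ncs"
    using that lie_poly_subset_FL by blast
  from \<open>x \<in> lie_poly S\<close> show ?thesis
  proof induction
    case zero
    then show ?case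
      using lin FL_zero[of S] unfolding linear_FL_def by (metis add_cancel_right_right)
  next
    case (lie x y)
    then show ?case by (blast intro: assms(4) sub)
  qed (use lin letter sub in \<open>simp_all add: linear_FL_def\<close>)
qed

lemma continuous_FL_I:
  assumes "\<And>x y. T (x + y) = T x + T y" "\<And>n x. fil n x \<Longrightarrow> fil n (T x)"
  shows "continuous_FL S (restrict T (FL S))"
  unfolding continuous_FL_def
proof (intro allI)
  fix n
  have "\<forall>i<n. hom_part i (restrict T (FL S) x) = hom_part i (restrict T (FL S) y)"
    if xy: "x \<in> FL S" "y \<in> FL S" and *: "\<forall>i<n. hom_part i x = hom_part i y" for x y
  proof -
    have "T (x - y) + T y = T x" by (simp flip: assms(1))
    then have "T x - T y = T (x - y)" by (simp add: algebra_simps)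
    moreover have "fil n (T (x - y))" using * by (intro assms(2)) (simp add: fil_diff_iff)
    ultimately have "\<forall>i<n. hom_part i (T x) = hom_part i (T y)" by (simp flip: fil_diff_iff)
    then show ?thesis
      using xy by simp
  qed
  then show "\<exists>m. \<forall>x\<in>FL S. \<forall>y\<in>FL S. (\<forall>i<m. hom_part i x = hom_part i y) \<longrightarrow>
      (\<forall>i<n. hom_part i (restrict T (FL S) x) = hom_part i (restrict T (FL S) y))"
    by blast
qed

lemma linear_FL_restrict:
  assumes "\<And>x y. T (x + y) = T x + T y" "\<And>c x. T (ncs_scale c x) = ncs_scale c (T x)"
  shows "linear_FL S (restrict T (FL S))"
  by (simp add: linear_FL_def FL_add FL_scale assms)

lemma FL_vecD: "v \<in> FL_vec S \<Longrightarrow> v a \<in> FL S"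
  by (cases "a \<in> S") (auto simp: FL_vec_def FL_zero)

lemma fil_FL_vec: "v \<in> FL_vec S \<Longrightarrow> fil 1 (v a)"
  by (blast intro: fil_FL FL_vecD)

lemma tder_ncs_FL:
  assumes "finite S" "v \<in> FL_vec S" "x \<in> FL S"
  shows "tder_ncs S v x \<in> FL S"
proof (rule FL_limit)
  have poly: "tder_ncs S v y \<in> FL S" if "y \<in> lie_poly S" for y
    using that
  proof induction
    case (lie x y)
    then show ?case
      unfolding tder_ncs_lie using lie_poly_subset_FL by (blast intro: FL_add FL_lie)
  qed (use assms(1) in \<open>auto simp: tder_ncs_add tder_ncs_scale tder_ncs_letter
      intro: FL_zero FL_add FL_scale FL_lie FL_letter FL_vecD[OF assms(2)]\<close>)
  fix n
  obtain y where y: "y \<in> lie_poly S" "fil n (x - y)" using FL_approx assms(3) .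
  have "fil (n + 1) (tder_ncs S v (x - y))"
    using y by (intro fil_tder_ncs fil_FL_vec[OF assms(2)])
  then have "fil n (tder_ncs S v x - tder_ncs S v y)"
    unfolding tder_ncs_diff by (rule fil_mono) simp
  with poly[OF y(1)] show "\<exists>z\<in>FL S. fil n (tder_ncs S v x - z)" by blast
qed

lemma tb_ncs_FL_vec:
  assumes "finite S" "u \<in> FL_vec S" "v \<in> FL_vec S"
  shows "tb_ncs S u v \<in> FL_vec S"
  using assms unfolding FL_vec_def[of S] mem_Collect_eq
  by (auto simp: tb_ncs_def intro!: FL_add FL_diff FL_lie
      tder_ncs_FL[OF assms(1,2)] tder_ncs_FL[OF assms(1,3)])

lemma tder_eq:
  assumes "finite S" "v \<in> FL_vec S"
  shows "tder S v = restrict (tder_ncs S v) (FL S)"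
  unfolding tder_def
proof (rule the_equality)
  have filtered: "fil n x \<Longrightarrow> fil n (tder_ncs S v x)" for n x
    using fil_tder_ncs[of 0 v n x S] by simp
  show *: "lie_derivation S (restrict (tder_ncs S v) (FL S)) \<and>
      (\<forall>a\<in>S. restrict (tder_ncs S v) (FL S) (letter a) = lie (letter a) (v a))"
    using assms
    by (auto simp: lie_derivation_def linear_FL_restrict continuous_FL_I filtered tder_ncs_add
        tder_ncs_scale tder_ncs_lie tder_ncs_letter tder_ncs_FL FL_lie FL_letter)
  define D' where "D' = restrict (tder_ncs S v) (FL S)"
  fix D assume D: "lie_derivation S D \<and> (\<forall>a\<in>S. D (letter a) = lie (letter a) (v a))"
  have "D x = D' x" if "x \<in> lie_poly S" for x
    using that
    by (rule linear_FL_lie_poly_eqI[rotated 4])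
      (use D *[folded D'_def] in \<open>auto simp: lie_derivation_def\<close>)
  then have "D x = D' x" if "x \<in> FL S" for x
    using D *[folded D'_def] that
    by (intro continuous_eq_on_FL[of S D D' x]) (auto simp: lie_derivation_def)
  moreover have "D \<in> extensional (FL S)" "D' \<in> extensional (FL S)"
    using D *[folded D'_def] by (auto simp: lie_derivation_def PiE_def)
  ultimately show "D = D'"
    by (intro extensionalityI[of _ "FL S"]) auto
qed

lemma tb_eq:
  assumes "finite S" "u \<in> FL_vec S" "v \<in> FL_vec S"
  shows "tb S u v = tb_ncs S u v"
  using assms by (intro ext) (simp add: tb_def tb_ncs_def tder_eq FL_vecD)

lemma tder_ncs_commutator:
  assumes "finite S" "x \<in> FL S"
  shows "tder_ncs S u (tder_ncs S v x) = tder_ncs S (tb_ncs S u v) x + tder_ncs S v (tder_ncs S u x)"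
proof -
  let ?\<theta> = "\<lambda>x. tder_ncs S u (tder_ncs S v x) - tder_ncs S v (tder_ncs S u x)
    - tder_ncs S (tb_ncs S u v) x"
  have filtered: "fil n x \<Longrightarrow> fil n (tder_ncs S v x)" for n x v
    using fil_tder_ncs[of 0 v n x S] by simp
  have "?\<theta> y = 0" if "y \<in> lie_poly S" for y
    using that
  proof induction
    case (letter a)
    have jacobi: "lie (lie x y) z - lie (lie x z) y = lie x (lie y z)" for x y z :: "('a, 'b) ncs"
      by (simp add: lie_def algebra_simps)
    from letter show ?case
      using jacobi[of "letter a" "u a" "v a"]
      by (simp add: tder_ncs_letter[OF assms(1)] tder_ncs_lie tb_ncs_def lie_simps algebra_simps)
  next
    case (lie x y)
    then show ?case by (simp add: tder_ncs_lie tder_ncs_add lie_simps algebra_simps)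
  qed (simp_all add: tder_ncs_add tder_ncs_scale algebra_simps flip: ncs.scale_right_diff_distrib)
  then have "?\<theta> x = 0"
    by (intro vanishes_on_FL[where \<theta> = ?\<theta>, OF assms(2)])
      (auto simp: tder_ncs_add intro: fil_diff filtered)
  then show ?thesis by (simp add: algebra_simps)
qed

section \<open>The differential equation\<close>

lemma ncs_coeff_map [simp]: "ncs_coeff (ncs_map f x) w = f (ncs_coeff x w)"
  by (simp add: ncs_map_def)

inductive_set const_span :: "'a set \<Rightarrow> ('a, rat fps) ncs set" for S :: "'a set" where
  zero: "0 \<in> const_span S"
| add: "l \<in> lie_poly S \<Longrightarrow> y \<in> const_span S
    \<Longrightarrow> ncs_scale c (ncs_map fps_const l) + y \<in> const_span S"

lemma const_span_add: "x \<in> const_span S \<Longrightarrow> y \<in> const_span S \<Longrightarrow> x + y \<in> const_span S"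
  by (induction rule: const_span.induct) (auto simp: add.assoc intro: const_span.intros)

lemma const_span_scale: "x \<in> const_span S \<Longrightarrow> ncs_scale c x \<in> const_span S"
  by (induction rule: const_span.induct) (auto simp: ncs.scale_right_distrib intro: const_span.intros)

lemma const_span_lie_poly: "l \<in> lie_poly S \<Longrightarrow> ncs_map fps_const l \<in> const_span S"
  using const_span.add[of l S 0 1] by (simp add: const_span.zero)

lemma ncs_map_const_lie:
  "ncs_map fps_const (lie x y) = lie (ncs_map fps_const x) (ncs_map fps_const y :: ('a, rat fps) ncs)"
  by (rule ncs_eqI)
    (simp add: lie_def ncs_coeff_mult fps_const_sum flip: fps_const_sub fps_const_mult)

lemma const_span_lie:
  assumes "x \<in> const_span S" "y \<in> const_span S"
  shows "lie x y \<in> const_span S"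
  using assms
proof (induction rule: const_span.induct)
  case (add l x c)
  have "lie (ncs_scale c (ncs_map fps_const l)) y \<in> const_span S"
    using add.prems
  proof (induction rule: const_span.induct)
    case (add m y d)
    then show ?case
      using const_span_scale[OF const_span_lie_poly[OF lie_poly.lie[OF \<open>l \<in> _\<close> \<open>m \<in> _\<close>]], of "c * d"]
      by (auto simp: lie_simps ncs_map_const_lie mult.commute intro: const_span_add)
  qed (auto intro: const_span.zero)
  with add show ?case by (auto simp: lie_simps intro: const_span_add)
qed (auto intro: const_span.zero)

lemma lie_poly_subset_const_span: "x \<in> lie_poly S \<Longrightarrow> x \<in> const_span S"
proof (induction rule: lie_poly.induct)
  case (letter a)
  have "letter a = ncs_map fps_const (letter a)" by (rule ncs_eqI) simp
  then show ?case using const_span_lie_poly lie_poly.letter[OF letter] by metis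
qed (auto intro: const_span.zero const_span_add const_span_scale const_span_lie)

lemma lie_poly_map_const:
  fixes x :: "('a, rat) ncs"
  shows "x \<in> lie_poly S \<Longrightarrow> ncs_map fps_const x \<in> lie_poly S"
proof (induction rule: lie_poly.induct)
  case (letter a)
  have "ncs_map fps_const (letter a) = letter a" by (rule ncs_eqI) simp
  then show ?case using lie_poly.letter[OF letter] by metis
next
  case zero
  have "ncs_map fps_const 0 = 0" by (rule ncs_eqI) simp
  then show ?case using lie_poly.zero by metis
next
  case (add x y)
  have "ncs_map fps_const (x + y) = ncs_map fps_const x + ncs_map fps_const y"
    by (rule ncs_eqI) (simp flip: fps_const_add)
  then show ?case using lie_poly.add[OF add.IH] by metis
next
  case (scale x c)
  have "ncs_map fps_const (ncs_scale c x) = ncs_scale (fps_const c) (ncs_map fps_const x)"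
    by (rule ncs_eqI) (simp flip: fps_const_mult)
  then show ?case using lie_poly.scale[OF scale.IH] by metis
next
  case (lie x y)
  then show ?case by (simp add: ncs_map_const_lie lie_poly.lie)
qed

lemma hom_part_map: "f 0 = 0 \<Longrightarrow> hom_part n (ncs_map f x) = ncs_map f (hom_part n x)"
  by (rule ncs_eqI) simp

lemma FL_map_const: "(x :: ('a, rat) ncs) \<in> FL S \<Longrightarrow> ncs_map fps_const x \<in> FL S"
  by (auto simp: FL_def hom_part_map intro: lie_poly_map_const)

lemma FL_map_linear:
  fixes \<phi> :: "rat fps \<Rightarrow> rat fps"
  assumes add: "\<And>p q. \<phi> (p + q) = \<phi> p + \<phi> q"
    and mult: "\<And>p c. \<phi> (p * fps_const c) = \<phi> p * fps_const c"
    and x: "x \<in> FL S"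
  shows "ncs_map \<phi> x \<in> FL S"
proof -
  have zero: "\<phi> 0 = 0" using add[of 0 0] by simp
  have "ncs_map \<phi> x \<in> lie_poly S" if "x \<in> const_span S" for x
    using that
  proof induction
    case zero
    have "ncs_map \<phi> 0 = 0" by (rule ncs_eqI) (simp add: \<open>\<phi> 0 = 0\<close>)
    then show ?case using lie_poly.zero by metis
  next
    case (add l y c)
    have "ncs_map \<phi> (ncs_scale c (ncs_map fps_const l) + y)
        = ncs_scale (\<phi> c) (ncs_map fps_const l) + ncs_map \<phi> y"
      by (rule ncs_eqI) (simp add: assms(1,2))
    then show ?case
      using lie_poly.add[OF lie_poly.scale[OF lie_poly_map_const[OF add.hyps(1)]] add.IH] by metis
  qed
  then show ?thesis
    using x by (simp add: FL_def hom_part_map zero lie_poly_subset_const_span)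
qed

lemma const_vec_FL_vec: "l \<in> FL_vec S \<Longrightarrow> const_vec l \<in> FL_vec S"
  by (auto simp: FL_vec_def const_vec_def FL_map_const intro: ncs_eqI)

lemma funpow_cong_on:
  assumes "\<And>x. x \<in> M \<Longrightarrow> T x = T' x" "\<And>x. x \<in> M \<Longrightarrow> T' x \<in> M" "x \<in> M"
  shows "(T ^^ k) x = (T' ^^ k) x" "(T' ^^ k) x \<in> M"
  by (induction k) (simp_all add: assms)

lemma op_series_cong_on:
  assumes "\<And>x. x \<in> M \<Longrightarrow> T x = T' x" "\<And>x. x \<in> M \<Longrightarrow> T' x \<in> M" "x \<in> M"
  shows "op_series F T x = op_series F T' x"
proof -
  have "(T ^^ k) x = (T' ^^ k) x" for k using assms by (rule funpow_cong_on)
  then show ?thesis by (simp add: op_series_def)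
qed

lemma op_series_vec_cong_on:
  assumes "\<And>x. x \<in> M \<Longrightarrow> T x = T' x" "\<And>x. x \<in> M \<Longrightarrow> T' x \<in> M" "x \<in> M"
  shows "op_series_vec F T x = op_series_vec F T' x"
proof -
  have "(T ^^ k) x = (T' ^^ k) x" for k using assms by (rule funpow_cong_on)
  then show ?thesis by (simp add: op_series_vec_def)
qed

definition Lambda_rhs ::
  "'a set \<Rightarrow> ('a \<Rightarrow> ('a, rat) ncs) \<Rightarrow> ('a \<Rightarrow> ('a, rat fps) ncs) \<Rightarrow> 'a \<Rightarrow> ('a, rat fps) ncs" where
  "Lambda_rhs S l L = op_series_vec todd_fps (tb_ncs S L) (\<lambda>b. op_exp (tder_ncs S L) (const_vec l b))"

lemma (in filtered_endo) op_series_FL: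
  assumes "\<And>x. x \<in> FL S \<Longrightarrow> T x \<in> FL S" "x \<in> FL S"
  shows "op_series F T x \<in> FL S"
proof -
  have "(T ^^ k) x \<in> FL S" for k by (induction k) (auto intro: assms)
  then show ?thesis unfolding op_series_nsum by (intro FL_nsum fil_scale FL_scale Tpow_fil)
qed

lemma (in filtered_endo) op_series_0: "op_series F T 0 = 0"
  using op_series_add[of F 0 0] by simp

context
  fixes S :: "'a set" and l :: "'a \<Rightarrow> ('a, rat) ncs"
  assumes fin: "finite S" and l: "l \<in> FL_vec S"
begin

lemma exp_tder_FL_vec:
  assumes "L \<in> FL_vec S"
  shows "(\<lambda>b. op_exp (tder_ncs S L) (const_vec l b)) \<in> FL_vec S"
proof -
  interpret D: filtered_endo "tder_ncs S L"
    by (intro filtered_endo_tder_ncs fil_FL_vec[OF assms])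
  show ?thesis
    using const_vec_FL_vec[OF l] D.op_series_0 tder_ncs_FL[OF fin assms]
    by (auto simp: FL_vec_def intro: D.op_series_FL)
qed

lemma Lambda_rhs_FL_vec:
  assumes "L \<in> FL_vec S"
  shows "Lambda_rhs S l L \<in> FL_vec S"
proof -
  interpret B: filtered_op "tb_ncs S L"
    by (intro filtered_op_tb_ncs fil_FL_vec[OF assms])
  have "(tb_ncs S L ^^ k) v \<in> FL_vec S" if "v \<in> FL_vec S" for v k
    by (induction k) (auto intro: tb_ncs_FL_vec fin assms that)
  then have *: "(tb_ncs S L ^^ k) (\<lambda>b. op_exp (tder_ncs S L) (const_vec l b)) \<in> FL_vec S" for k
    using exp_tder_FL_vec assms by blast
  have "Lambda_rhs S l L a \<in> FL S" for a
    unfolding Lambda_rhs_def B.op_series_vec_nsum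
    by (intro FL_nsum fil_scale FL_scale B.pow_fil FL_vecD *)
  moreover have "Lambda_rhs S l L a = 0" if "a \<notin> S" for a
    unfolding Lambda_rhs_def B.op_series_vec_nsum using that *
    by (simp add: FL_vec_def nsum_def zero_ncs_def)
  ultimately show ?thesis by (auto simp: FL_vec_def)
qed

lemma Lambda_rhs_eq:
  assumes "L \<in> FL_vec S"
  shows "op_series_vec todd_fps (tb S L) (\<lambda>b. op_exp (tder S L) (const_vec l b)) = Lambda_rhs S l L"
proof -
  have "op_exp (tder S L) x = op_exp (tder_ncs S L) x" if "x \<in> FL S" for x
    by (rule op_series_cong_on[of "FL S"]) (auto simp: that tder_eq fin assms tder_ncs_FL)
  then have "(\<lambda>b. op_exp (tder S L) (const_vec l b)) = (\<lambda>b. op_exp (tder_ncs S L) (const_vec l b))"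
    using FL_vecD[OF const_vec_FL_vec[OF l]] by blast
  then show ?thesis
    unfolding Lambda_rhs_def using exp_tder_FL_vec[OF assms]
    by (simp, intro op_series_vec_cong_on[of "FL_vec S"]) (auto simp: tb_eq tb_ncs_FL_vec fin assms)
qed

definition Lambda_step :: "('a \<Rightarrow> ('a, rat fps) ncs) \<Rightarrow> 'a \<Rightarrow> ('a, rat fps) ncs" where
  "Lambda_step L = (\<lambda>a. ncs_map fps_integral0 (Lambda_rhs S l L a))"

lemma Lambda_step_FL_vec:
  assumes "L \<in> FL_vec S"
  shows "Lambda_step L \<in> FL_vec S"
  using Lambda_rhs_FL_vec[OF assms] unfolding FL_vec_def Lambda_step_def
  by (auto intro!: FL_map_linear ncs_eqI simp: fps_integral_def fps_eq_iff algebra_simps)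

lemma Lambda_ode_iff: "Lambda_ode S l L \<longleftrightarrow> L \<in> FL_vec S \<and> Lambda_step L = L"
proof (cases "L \<in> FL_vec S")
  case True
  have int: "q = fps_integral0 p \<longleftrightarrow> fps_nth q 0 = 0 \<and> fps_deriv q = p" for p q :: "rat fps"
    using fps_integral0_deriv[of q] fps_deriv_fps_integral[of p 0] by auto
  have "ncs_map fps_integral0 x = y \<longleftrightarrow> ncs_map (\<lambda>p. fps_nth p 0) y = 0 \<and> ncs_map fps_deriv y = x"
    for x y :: "('a, rat fps) ncs"
    by (metis (no_types, lifting) int ncs_coeff_map ncs_coeff_simps(1) ncs_eqI)
  moreover have "Lambda_step L a = L a" if "a \<notin> S" for a
    using that Lambda_step_FL_vec[OF True] True by (simp add: FL_vec_def)
  ultimately show ?thesis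
    using True unfolding Lambda_ode_def fun_eq_iff Lambda_rhs_eq[OF True] Lambda_step_def by metis
qed (simp add: Lambda_ode_def)

lemma fil_tder_ncs_diff:
  assumes "\<And>a. fil 1 (u a)" "\<And>a. fil n (u a - v a)" "fil (Suc n) (x - y)" "fil 1 y"
  shows "fil (Suc n) (tder_ncs S u x - tder_ncs S v y)"
proof -
  have "tder_ncs S u x - tder_ncs S v y = tder_ncs S u (x - y) + tder_ncs S (\<lambda>a. u a - v a) y"
    by (simp add: tder_ncs_diff tder_ncs_diff_left)
  moreover have "fil (Suc n + 1) (tder_ncs S u (x - y))" "fil (1 + n) (tder_ncs S (\<lambda>a. u a - v a) y)"
    by (intro fil_tder_ncs assms)+
  then have "fil (Suc n) (tder_ncs S u (x - y))" "fil (Suc n) (tder_ncs S (\<lambda>a. u a - v a) y)"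
    by (auto elim: fil_mono)
  ultimately show ?thesis by (simp add: fil_add)
qed

lemma Lambda_step_contraction:
  assumes L: "\<And>a. fil 1 (L a)" "\<And>a. fil 1 (L' a)" "\<And>a. fil n (L a - L' a)"
  shows "fil (Suc n) (Lambda_step L a - Lambda_step L' a)"
proof -
  interpret D: filtered_endo "tder_ncs S L" by (intro filtered_endo_tder_ncs L)
  interpret D': filtered_endo "tder_ncs S L'" by (intro filtered_endo_tder_ncs L)
  interpret B: filtered_op "tb_ncs S L" by (intro filtered_op_tb_ncs L)
  interpret B': filtered_op "tb_ncs S L'" by (intro filtered_op_tb_ncs L)
  have Dpow: "fil (Suc n) ((tder_ncs S L ^^ k) x - (tder_ncs S L' ^^ k) x) \<and> fil 1 ((tder_ncs S L' ^^ k) x)"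
    if "fil 1 x" for k x
  proof (induction k)
    case (Suc k)
    then have "fil 1 (tder_ncs S L' ((tder_ncs S L' ^^ k) x))"
      by (intro fil_mono[OF D'.T_raise]) auto
    with Suc show ?case by (auto intro!: fil_tder_ncs_diff L)
  qed (use that in simp)
  have exp: "fil (Suc n) (op_exp (tder_ncs S L) x - op_exp (tder_ncs S L') x)" if "fil 1 x" for x
    unfolding D.op_series_nsum D'.op_series_nsum nsum_diff ncs.scale_right_diff_distrib[symmetric]
    using Dpow[OF that] by (intro fil_nsum fil_scale) blast
  have tb: "fil (Suc n) (tb_ncs S L v a - tb_ncs S L' v' a)"
    if v: "\<And>a. fil (Suc n) (v a - v' a)" "\<And>a. fil 1 (v a)" "\<And>a. fil 1 (v' a)" for v v' a
  proof -
    have "tb_ncs S L v a - tb_ncs S L' v' a = lie (L a) (v a - v' a) + lie (L a - L' a) (v' a)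
        + (tder_ncs S L (v a) - tder_ncs S L' (v' a))
        - (tder_ncs S (\<lambda>a. v a - v' a) (L a) + tder_ncs S v' (L a - L' a))"
      by (simp add: tb_ncs_def lie_simps tder_ncs_diff tder_ncs_diff_left)
    moreover have "fil (1 + Suc n) (lie (L a) (v a - v' a))" "fil (n + 1) (lie (L a - L' a) (v' a))"
      by (intro fil_lie L v)+
    moreover have "fil (1 + Suc n) (tder_ncs S (\<lambda>a. v a - v' a) (L a))"
      "fil (n + 1) (tder_ncs S v' (L a - L' a))"
      by (intro fil_tder_ncs L v)+
    moreover have "fil (Suc n) (tder_ncs S L (v a) - tder_ncs S L' (v' a))"
      by (intro fil_tder_ncs_diff L v)
    ultimately show ?thesis
      by (auto intro!: fil_add fil_diff elim: fil_mono)
  qed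
  have Bpow: "fil (Suc n) ((tb_ncs S L ^^ k) v a - (tb_ncs S L' ^^ k) v' a)"
    if v: "\<And>a. fil (Suc n) (v a - v' a)" "\<And>a. fil 1 (v a)" "\<And>a. fil 1 (v' a)" for k v v' a
    using B.pow_filtered[of 1 v] B'.pow_filtered[of 1 v'] v
    by (induction k arbitrary: a) (auto intro!: tb)
  have rhs: "fil (Suc n) (Lambda_rhs S l L a - Lambda_rhs S l L' a)"
    unfolding Lambda_rhs_def B.op_series_vec_nsum B'.op_series_vec_nsum nsum_diff
    unfolding ncs.scale_right_diff_distrib[symmetric]
    by (intro fil_nsum fil_scale Bpow exp D.op_series_filtered D'.op_series_filtered
        fil_FL_vec[OF const_vec_FL_vec[OF l]])
  then show ?thesis
    by (auto simp: fil_def Lambda_step_def)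
qed

lemma Lambda_ode_ex1: "\<exists>!L. Lambda_ode S l L"
proof -
  define X where "X n = (Lambda_step ^^ n) (\<lambda>_. 0)" for n
  have X_Suc: "X (Suc n) = Lambda_step (X n)" for n by (simp add: X_def)
  have X: "X n \<in> FL_vec S" for n
  proof (induction n)
    case 0
    show ?case by (simp add: X_def FL_vec_def FL_zero)
  qed (simp add: X_Suc Lambda_step_FL_vec)
  have Cauchy1: "fil n (X (Suc n) a - X n a)" for n a
    by (induction n arbitrary: a) (auto simp: X_Suc intro!: Lambda_step_contraction fil_FL_vec[OF X]
      fil_FL_vec[OF Lambda_step_FL_vec[OF X]])
  have Cauchy: "fil n (X m a - X n a)" if "n \<le> m" for m n a
    using that
  proof (induction m rule: dec_induct)
    case (step m)
    have "fil n (X (Suc m) a - X m a)" by (rule fil_mono[OF Cauchy1]) (use step in simp)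
    with step show ?case by (blast intro: fil_triangle)
  qed simp
  define L where "L a = Abs_ncs (\<lambda>w. ncs_coeff (X (Suc (length w)) a) w)" for a
  have LX: "fil n (L a - X n a)" for n a
    unfolding fil_def
  proof (intro allI impI)
    fix w :: "'a list" assume "length w < n"
    then show "ncs_coeff (L a - X n a) w = 0"
      using Cauchy[of "Suc (length w)" n a] by (simp add: L_def fil_def)
  qed
  have L: "L \<in> FL_vec S"
    using X unfolding FL_vec_def by (auto simp: L_def zero_ncs_def intro!: FL_limit LX)
      (metis L_def LX)
  have "Lambda_step L = L"
  proof (intro ext fil_eqI)
    fix a n
    have "fil (Suc n) (Lambda_step L a - X (Suc n) a)"
      unfolding X_Suc by (intro Lambda_step_contraction LX fil_FL_vec[OF X] fil_FL_vec[OF L])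
    then have "fil (Suc n) (Lambda_step L a - L a)"
      using LX by (blast intro: fil_triangle fil_commute)
    then show "fil n (Lambda_step L a - L a)" by (rule fil_mono) simp
  qed
  moreover have "M = L" if M: "M \<in> FL_vec S" "Lambda_step M = M" for M
  proof (intro ext fil_eqI)
    show "fil n (M a - L a)" for n a
    proof (induction n arbitrary: a)
      case (Suc n)
      then have "fil (Suc n) (Lambda_step M a - Lambda_step L a)"
        by (intro Lambda_step_contraction fil_FL_vec[OF M(1)] fil_FL_vec[OF L])
      then show ?case by (simp add: M \<open>Lambda_step L = L\<close>)
    qed simp
  qed
  ultimately show ?thesis
    unfolding Lambda_ode_iff using L by blast
qed

end

section \<open>Differentiation with respect to \<open>t\<close>\<close>

abbreviation dt :: "('a, rat fps) ncs \<Rightarrow> ('a, rat fps) ncs" where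
  "dt \<equiv> ncs_map fps_deriv"

lemma dt_add: "dt (x + y) = dt x + dt y"
  and dt_scale: "dt (ncs_scale p x) = ncs_scale (fps_deriv p) x + ncs_scale p (dt x)"
  and dt_const_scale: "dt (ncs_scale (fps_const c) x) = ncs_scale (fps_const c) (dt x)"
  and dt_diff: "dt (x - y) = dt x - dt y"
  and dt_letter: "dt (letter a) = 0"
  and dt_const_vec: "dt (const_vec l a) = 0"
  by (rule ncs_eqI; simp add: algebra_simps const_vec_def)+

lemma dt_mult: "dt (x * y) = dt x * y + x * dt y"
  by (rule ncs_eqI) (simp add: ncs_coeff_mult fps_deriv_sum sum.distrib add.commute)

lemma dt_lie: "dt (lie x y) = lie (dt x) y + lie x (dt y)"
  by (simp add: lie_def dt_diff dt_mult)

lemma fil_dt: "fil n x \<Longrightarrow> fil n (dt x)"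
  by (simp add: fil_def)

lemma dt_tder_ncs:
  assumes "finite S" "x \<in> FL S"
  shows "dt (tder_ncs S v x) = tder_ncs S (\<lambda>a. dt (v a)) x + tder_ncs S v (dt x)"
proof -
  let ?\<theta> = "\<lambda>x. dt (tder_ncs S v x) - tder_ncs S v (dt x) - tder_ncs S (\<lambda>a. dt (v a)) x"
  have filtered: "fil n x \<Longrightarrow> fil n (tder_ncs S v x)" for n x v
    using fil_tder_ncs[of 0 v n x S] by simp
  have "?\<theta> y = 0" if "y \<in> lie_poly S" for y
    using that
  proof induction
    case zero
    have "dt 0 = (0 :: ('a, rat fps) ncs)" by (rule ncs_eqI) simp
    then show ?case by simp
  next
    case (lie x y)
    then show ?case by (simp add: tder_ncs_lie tder_ncs_add dt_add dt_lie lie_simps algebra_simps)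
  next
    case (scale x c)
    then show ?case
      by (simp add: tder_ncs_scale tder_ncs_add dt_scale algebra_simps
          flip: ncs.scale_right_distrib)
  qed (simp_all add: tder_ncs_add tder_ncs_letter[OF assms(1)] dt_add dt_lie dt_letter algebra_simps)
  then have "?\<theta> x = 0"
    by (intro vanishes_on_FL[where \<theta> = ?\<theta>, OF assms(2)])
      (auto simp: tder_ncs_add dt_add intro: fil_diff filtered fil_dt)
  then show ?thesis by (simp add: algebra_simps)
qed

definition at_zero :: "('a, rat fps) ncs \<Rightarrow> ('a, rat) ncs" where
  "at_zero = ncs_map (\<lambda>p. fps_nth p 0)"

lemma at_zero_simps:
  "at_zero 0 = 0"
  "at_zero (x + y) = at_zero x + at_zero y"
  "at_zero (x - y) = at_zero x - at_zero y"
  "at_zero (- x) = - at_zero x"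
  "at_zero (ncs_scale p x) = ncs_scale (fps_nth p 0) (at_zero x)"
  "at_zero (x * y) = at_zero x * at_zero y"
  by (rule ncs_eqI; simp add: at_zero_def ncs_coeff_mult fps_sum_nth)+

lemma at_zero_sum: "at_zero (sum f A) = (\<Sum>i\<in>A. at_zero (f i))"
  by (induction A rule: infinite_finite_induct) (auto simp: at_zero_simps)

lemma at_zero_deriv_ncs:
  assumes "\<And>a. at_zero (g a) = 0"
  shows "at_zero (deriv_ncs S g x) = 0"
proof (rule ncs_eqI)
  have "at_zero (dhead S g x) = 0" for x
    by (simp add: dhead_def at_zero_sum at_zero_simps assms)
  then have "fps_nth (ncs_coeff (dhead S g x) w) 0 = 0" for x w
    by (metis at_zero_def ncs_coeff_map ncs_coeff_simps(1))
  then have "fps_nth (ncs_coeff (deriv_ncs S g x) w) 0 = 0" for w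
    by (induction w arbitrary: x) (simp_all add: ncs_coeff_deriv_ncs)
  then show "ncs_coeff (at_zero (deriv_ncs S g x)) w = ncs_coeff 0 w" for w
    by (simp add: at_zero_def)
qed

lemma at_zero_tder_ncs:
  "(\<And>a. at_zero (v a) = 0) \<Longrightarrow> at_zero (tder_ncs S v x) = 0"
  unfolding tder_ncs_def by (rule at_zero_deriv_ncs) (simp add: lie_def at_zero_simps)

lemma (in filtered_endo) at_zero_op_exp:
  assumes "\<And>x. at_zero (T x) = 0"
  shows "at_zero (op_exp T x) = at_zero x"
proof -
  have "op_exp T x = x + nsum (\<lambda>k. ncs_scale (fps_const (fps_nth (fps_exp 1) (Suc k))) (T ((T ^^ k) x)))"
    unfolding op_series_nsum by (subst nsum_shift) (auto intro: fil_scale Tpow_fil)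
  moreover have "at_zero (nsum (\<lambda>k. ncs_scale (c k) (T (y k)))) = 0" for c and y :: "nat \<Rightarrow> _"
  proof (rule ncs_eqI)
    have "fps_nth (ncs_coeff (T y) w) 0 = 0" for y w
      using assms[of y] by (metis at_zero_def ncs_coeff_map ncs_coeff_simps(1))
    then show "ncs_coeff (at_zero (nsum (\<lambda>k. ncs_scale (c k) (T (y k))))) w = ncs_coeff 0 w" for w
      by (simp add: at_zero_def nsum_def fps_sum_nth)
  qed
  ultimately show ?thesis by (simp add: at_zero_simps)
qed

lemma linear_ode_unique:
  assumes c: "fil 1 c" and ode: "dt x = lie c x" "dt y = lie c y" and init: "at_zero x = at_zero y"
  shows "x = y"
proof (rule fil_eqI)
  define z where "z = x - y"
  have z: "dt z = lie c z" "at_zero z = 0"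
    by (simp_all add: z_def dt_diff ode lie_simps at_zero_simps init)
  show "fil n (x - y)" for n
    unfolding z_def[symmetric]
  proof (induction n)
    case (Suc n)
    have "fil (1 + n) (dt z)" unfolding z by (intro fil_lie c Suc)
    then have "fps_deriv (ncs_coeff z w) = 0" if "length w < Suc n" for w
      using that by (simp add: fil_def)
    moreover have "fps_nth (ncs_coeff z w) 0 = 0" for w
      using z(2) by (metis at_zero_def ncs_coeff_map ncs_coeff_simps(1))
    ultimately show ?case
      by (simp add: fil_def)
  qed simp
qed

section \<open>The exponential of the tangential derivation\<close>

lemma todd_fps_inverse: "Abs_fps (\<lambda>k. 1 / fact (Suc k)) * todd_fps = 1"
proof -
  have "Abs_fps (\<lambda>k. 1 / fact (Suc k)) * fps_X = (fps_exp 1 - 1 :: rat fps)"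
    by (rule fps_ext, case_tac n) (simp_all add: field_simps)
  then have "Abs_fps (\<lambda>k. 1 / fact (Suc k)) * todd_fps * fps_X = 1 * fps_X"
    using todd_fps_mult by (simp add: ac_simps)
  then show ?thesis by (simp only: mult_cancel_right fps_X_neq_zero simp_thms)
qed

lemma dt_op_exp_lie:
  assumes c: "fil 1 c" "dt c = 0" and a: "dt x = 0"
  shows "dt (op_exp (lie (ncs_scale fps_X c)) x) = lie c (op_exp (lie (ncs_scale fps_X c)) x)"
proof -
  let ?T = "lie (ncs_scale fps_X c)"
  interpret T: filtered_endo ?T
  proof
    show "fil (Suc m) (?T x)" if "fil m x" for m x
      using fil_lie[OF fil_scale[OF c(1)] that] by simp
  qed (simp_all add: lie_simps mult.commute)
  define A where "A k = (case k of 0 \<Rightarrow> dt | Suc j \<Rightarrow> if j = 0 then (\<lambda>x. - lie c x) else (\<lambda>x. 0))" for k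
  let ?y = "op_exp ?T x"
  have "op_exp ?T (A 0 x) = nsum (\<lambda>k. ncs_scale (fps_const (1 / fact k)) (A k ?y))"
  proof (rule T.op_exp_commute[of UNIV])
    show "fil (k + m) (A k x)" if "fil m x" for k m x
      using that fil_lie[OF c(1) that] by (auto simp: A_def fil_dt fil_minus split: nat.split)
    show "?T (A k x) = A (Suc k) x + A k (?T x)" for k x
      by (auto simp: A_def lie_simps dt_scale dt_lie c split: nat.split)
  qed (auto simp: A_def lie_simps dt_add dt_const_scale split: nat.split)
  also have "\<dots> = dt ?y - lie c ?y"
  proof -
    have A_fil: "fil k (A k ?y)" for k
      using fil_lie[OF c(1), of 0 ?y] by (auto simp: A_def fil_minus split: nat.split)
    show ?thesis
      by (subst nsum_shift, intro fil_scale A_fil, subst nsum_shift,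
        rule fil_mono, rule fil_scale, rule A_fil, simp)
        (simp add: A_def nsum_def zero_ncs_def[symmetric])
  qed
  finally show ?thesis by (simp add: A_def a T.op_series_0)
qed

context
  fixes S :: "'a set" and l :: "'a \<Rightarrow> ('a, rat) ncs" and L :: "'a \<Rightarrow> ('a, rat fps) ncs"
  assumes fin: "finite S" and l: "l \<in> FL_vec S" and ode: "Lambda_ode S l L"
begin

lemma Lambda_FL_vec: "L \<in> FL_vec S"
  using ode by (simp add: Lambda_ode_def)

lemma at_zero_Lambda: "at_zero (L a) = 0"
  using ode by (cases "a \<in> S") (auto simp: Lambda_ode_def FL_vec_def at_zero_simps at_zero_def[symmetric])

lemma dt_Lambda: "dt (L a) = Lambda_rhs S l L a"
proof (cases "a \<in> S")
  case True
  then show ?thesis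
    using ode Lambda_rhs_eq[OF fin l Lambda_FL_vec] by (auto simp: Lambda_ode_def)
next
  case False
  have "dt 0 = (0 :: ('a, rat fps) ncs)" by (rule ncs_eqI) simp
  then show ?thesis
    using False Lambda_FL_vec Lambda_rhs_FL_vec[OF fin l Lambda_FL_vec] by (simp add: FL_vec_def)
qed

abbreviation "D \<equiv> tder_ncs S L"
abbreviation "D' \<equiv> \<lambda>x. - tder_ncs S L x"

interpretation D: filtered_endo D
  by (intro filtered_endo_tder_ncs fil_FL_vec[OF Lambda_FL_vec])

interpretation D': filtered_endo D'
  by (rule D.filtered_endo_neg)

interpretation B: filtered_op "tb_ncs S L"
  by (intro filtered_op_tb_ncs fil_FL_vec[OF Lambda_FL_vec])

lemma op_exp_D'_lie: "op_exp D' (lie x y) = lie (op_exp D' x) (op_exp D' y)"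
proof -
  have diff: "op_exp D' (x - y) = op_exp D' x - op_exp D' y" for x y
    using D'.op_series_add[of _ "x - y" y] by simp
  have "op_exp D' (x * y) = op_exp D' x * op_exp D' y" for x y
    by (rule D'.op_exp_mult) (simp add: tder_ncs_mult)
  then show ?thesis by (simp add: lie_def diff)
qed

lemma D_FL: "x \<in> FL S \<Longrightarrow> D x \<in> FL S"
  by (rule tder_ncs_FL[OF fin Lambda_FL_vec])

lemma op_exp_D_FL: "x \<in> FL S \<Longrightarrow> op_exp D x \<in> FL S" "x \<in> FL S \<Longrightarrow> op_exp D' x \<in> FL S"
  by (auto intro: D.op_series_FL D'.op_series_FL FL_minus D_FL)

lemma dt_op_exp_D':
  assumes a: "a \<in> S"
  shows "dt (op_exp D' (letter a)) = lie (const_vec l a) (op_exp D' (letter a))"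
proof -
  let ?W = "\<lambda>k. (tb_ncs S L ^^ k) (\<lambda>a. dt (L a))" and ?x = "op_exp D' (letter a)"
  let ?E = "\<lambda>b. op_exp D (const_vec l b)"
  define A where "A k = (case k of 0 \<Rightarrow> dt | Suc j \<Rightarrow> \<lambda>x. - tder_ncs S (?W j) x)" for k
  have x: "?x \<in> FL S" by (intro op_exp_D_FL FL_letter a)
  have W: "fil (Suc k) (?W k b)" for k b
    using B.pow_raise[of 1 "\<lambda>a. dt (L a)" k b] fil_dt[OF fil_FL_vec[OF Lambda_FL_vec]] by simp
  have "op_exp D (A 0 ?x) = nsum (\<lambda>k. ncs_scale (fps_const (1 / fact k)) (A k (op_exp D ?x)))"
  proof (rule D.op_exp_commute[of "FL S", OF D_FL x])
    show "fil (k + m) (A k x)" if "fil m x" for k m x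
      using that fil_tder_ncs[OF W that]
      by (auto simp: A_def fil_dt add.commute intro!: fil_minus split: nat.split)
    show "D (A k x) = A (Suc k) x + A k (D x)" if "x \<in> FL S" for k x
    proof (cases k)
      case 0
      then show ?thesis using dt_tder_ncs[OF fin that, of L] by (simp add: A_def)
    next
      case (Suc j)
      then show ?thesis
        using tder_ncs_commutator[OF fin that, of L "?W j"] by (simp add: A_def tder_ncs_minus)
    qed
  qed (auto simp: A_def tder_ncs_add tder_ncs_scale dt_add dt_const_scale split: nat.split)
  also have "op_exp D ?x = letter a" by (rule D.op_exp_neg_inverse)
  also have "nsum (\<lambda>k. ncs_scale (fps_const (1 / fact k)) (A k (letter a)))
      = - nsum (\<lambda>k. lie (letter a) (ncs_scale (fps_const (1 / fact (Suc k))) (?W k a)))"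
  proof -
    have "fil k (A k (letter a))" for k
    proof (cases k)
      case (Suc j)
      then show ?thesis
        using fil_lie[OF fil_0 W[of j a], of "letter a"]
        by (simp add: A_def tder_ncs_letter fin a fil_minus)
    qed simp
    then show ?thesis
      by (subst nsum_shift)
        (auto simp: A_def dt_letter tder_ncs_letter fin a nsum_minus lie_simps intro: fil_scale)
  qed
  also have "\<dots> = - lie (letter a)
      (op_series_vec (Abs_fps (\<lambda>k. 1 / fact (Suc k))) (tb_ncs S L) (\<lambda>a. dt (L a)) a)"
    unfolding B.op_series_vec_nsum
    by (subst nsum_additive[of "lie (letter a)"])
      (auto simp: lie_simps intro: fil_scale B.pow_fil fil_lie[of 0, simplified])
  also have "(\<lambda>a. dt (L a)) = op_series_vec todd_fps (tb_ncs S L) ?E"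
    by (rule ext) (simp add: dt_Lambda Lambda_rhs_def)
  also have "op_series_vec (Abs_fps (\<lambda>k. 1 / fact (Suc k))) (tb_ncs S L) \<dots> a = ?E a"
    by (simp only: B.op_series_vec_comp todd_fps_inverse B.op_series_vec_1)
  finally have "op_exp D (dt ?x) = - lie (letter a) (?E a)"
    by (simp add: A_def)
  then have "op_exp D' (op_exp D (dt ?x)) = op_exp D' (lie (?E a) (letter a))"
    by (simp add: lie_def)
  then show ?thesis
    by (simp add: D.op_exp_neg_inverse op_exp_D'_lie)
qed

lemma op_exp_D'_letter:
  assumes "a \<in> S"
  shows "op_exp D' (letter a) = op_exp (lie (t_times_vec l a)) (letter a)"
proof (rule linear_ode_unique)
  let ?c = "const_vec l a"
  show c: "fil 1 ?c" by (rule fil_FL_vec[OF const_vec_FL_vec[OF l]])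
  show "dt (op_exp D' (letter a)) = lie ?c (op_exp D' (letter a))"
    by (rule dt_op_exp_D'[OF assms])
  show "dt (op_exp (lie (t_times_vec l a)) (letter a)) = lie ?c (op_exp (lie (t_times_vec l a)) (letter a))"
    unfolding t_times_vec_def by (rule dt_op_exp_lie[OF c dt_const_vec dt_letter])
  interpret T: filtered_endo "lie (t_times_vec l a)"
  proof
    show "fil (Suc m) (lie (t_times_vec l a) x)" if "fil m x" for m x
      using fil_lie[OF fil_scale[OF c] that] by (simp add: t_times_vec_def)
  qed (simp_all add: lie_simps)
  have "at_zero (op_exp (lie (t_times_vec l a)) (letter a)) = at_zero (letter a)"
    by (rule T.at_zero_op_exp) (simp add: lie_def t_times_vec_def at_zero_simps)
  moreover have "at_zero (op_exp D' (letter a)) = at_zero (letter a)"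
    by (rule D'.at_zero_op_exp) (simp add: at_zero_simps at_zero_tder_ncs at_zero_Lambda)
  ultimately show "at_zero (op_exp D' (letter a)) = at_zero (op_exp (lie (t_times_vec l a)) (letter a))"
    by simp
qed

lemma restrict_op_exp_tder:
  "restrict (op_exp (\<lambda>x. - tder S L x)) (FL S) = restrict (op_exp D') (FL S)"
  by (rule restrict_ext, rule op_series_cong_on[of "FL S"])
    (auto simp: tder_eq fin Lambda_FL_vec intro: FL_minus D_FL)

lemma lie_automorphism_op_exp: "lie_automorphism S (restrict (op_exp D') (FL S))"
proof -
  have "bij_betw (op_exp D') (FL S) (FL S)"
    by (rule bij_betw_byWitness[where f' = "op_exp D"]) (auto simp: D.op_exp_neg_inverse op_exp_D_FL)
  then have "bij_betw (restrict (op_exp D') (FL S)) (FL S) (FL S)"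
    by (simp cong: bij_betw_cong)
  then show ?thesis
    using op_exp_D_FL
    by (simp add: lie_automorphism_def linear_FL_restrict continuous_FL_I D'.op_series_add
        D'.op_series_scale D'.op_series_filtered op_exp_D'_lie FL_lie)
qed

lemma tconj_eq: "tconj S (t_times_vec l) = restrict (op_exp D') (FL S)"
  unfolding tconj_def
proof (rule the_equality)
  define G where "G = restrict (op_exp D') (FL S)"
  show *: "lie_automorphism S (restrict (op_exp D') (FL S)) \<and>
      (\<forall>a\<in>S. restrict (op_exp D') (FL S) (letter a) = op_exp (lie (t_times_vec l a)) (letter a))"
    by (auto simp: FL_letter op_exp_D'_letter lie_automorphism_op_exp)
  fix F assume F: "lie_automorphism S F \<and>
    (\<forall>a\<in>S. F (letter a) = op_exp (lie (t_times_vec l a)) (letter a))"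
  have "F x = G x" if "x \<in> lie_poly S" for x
    using that
    by (rule linear_FL_lie_poly_eqI[rotated 4])
      (use F *[folded G_def] in \<open>auto simp: lie_automorphism_def\<close>)
  then have "F x = G x" if "x \<in> FL S" for x
    using F *[folded G_def] that
    by (intro continuous_eq_on_FL[of S F G x]) (auto simp: lie_automorphism_def)
  moreover have "F \<in> extensional (FL S)" "G \<in> extensional (FL S)"
    using F *[folded G_def] by (auto simp: lie_automorphism_def PiE_def)
  ultimately show "F = G"
    by (intro extensionalityI[of _ "FL S"]) auto
qed

end

theorem proposition2p8:
  fixes S :: "'a set" and l :: "'a \<Rightarrow> ('a, rat) ncs"
  assumes "finite S" and "l \<in> FL_vec S"
  shows "(\<exists>!L. Lambda_ode S l L) \<and>
    (\<forall>L. Lambda_ode S l L \<longrightarrow>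
      lie_automorphism S (tconj S (t_times_vec l)) \<and>
      tconj S (t_times_vec l) = restrict (op_exp (\<lambda>x. - tder S L x)) (FL S))"
  using Lambda_ode_ex1[OF assms] lie_automorphism_op_exp[OF assms] tconj_eq[OF assms]
    restrict_op_exp_tder[OF assms] by simp

end
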